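(* Let $X$ be a uniformly smooth Banach space and let $\Omega\subsetneq X$ be a convex domain with quasihyperbolic metric $k$. Let $x,y\in\Omega$ and $r,s>0$. If $B_k(y,s)\subset B_k(x,r)$ and $z\in S_k(x,r)\cap S_k(y,s)$, then the quasihyperbolic spheres $S_k(x,r)$ and $S_k(y,s)$ have the same tangent space at $z$.
   Context: $X$ is a real Banach space with $\dim X\ge2$. Its modulus of smoothness is $\rho_X(\tau)=\sup\{(\|u+v\|+\|u-v\|)/2-1:\ u,v\in X,\ \|u\|=1,\ \|v\|=\tau\}$, $\tau>0$, and $X$ is uniformly smooth if $\lim_{\tau\to0^+}\rho_X(\tau)/\tau=0$. A domain is a nonempty open connected set. For a domain $\Omega\subsetneq X$ write $d(x)=\mathrm{dist}(x,\partial\Omega)$. The quasihyperbolic length of a rectifiable path $\gamma$ in $\Omega$ is $\ell_k(\gamma)=\int_\gamma \frac{\|d\gamma\|}{d(\gamma)}$ (integral with respect to norm arc length), and the quasihyperbolic metric is $k(x,y)=\inf_\gamma\ell_k(\gamma)$, the infimum being over all rectifiable paths $\gamma$ in $\Omega$ joining $x$ and $y$. $B_k(a,r)=\{u\in\Omega:k(a,u)\le r\}$ and $S_k(a,r)=\{u\in\Omega:k(a,u)=r\}$. It is known (Klén, Rasila and Talponen) that for $X$ uniformly smooth and $\Omega$ convex, for every $a\in\Omega$ the function $k(a,\cdot)$ is continuously Fréchet differentiable on $\Omega\setminus\{a\}$; the tangent space of $S_k(a,r)$ at $u\in S_k(a,r)$, $r>0$, is the affine subspace $u+\ker k(a,\cdot)'(u)$,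 where $k(a,\cdot)'(u)\in X^*$ is the Fréchet derivative at $u$. *)

theory Defs
  imports "HOL-Analysis.Analysis"
begin

section \<open>Uniform smoothness\<close>

definition modulus_of_smoothness :: "'a::real_normed_vector itself \<Rightarrow> real \<Rightarrow> real" where
  "modulus_of_smoothness TYPE('a) \<tau> =
     Sup {(norm (u + v) + norm (u - v)) / 2 - 1 | u v :: 'a. norm u = 1 \<and> norm v = \<tau>}"

definition uniformly_smooth :: "'a::real_normed_vector itself \<Rightarrow> bool" where
  "uniformly_smooth TYPE('a) \<longleftrightarrow>
     ((\<lambda>\<tau>. modulus_of_smoothness TYPE('a) \<tau> / \<tau>) \<longlongrightarrow> 0) (at_right 0)"

section \<open>Rectifiable paths and integration with respect to arc length\<close>

definition polygonal_sums :: "(real \<Rightarrow> 'a::real_normed_vector) \<Rightarrow> real \<Rightarrow> real \<Rightarrow> real set" where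
  "polygonal_sums \<gamma> a b =
     {\<Sum>i<n. norm (\<gamma> (t (Suc i)) - \<gamma> (t i)) | n t.
        (\<forall>i\<le>n. t i \<in> {a..b}) \<and> (\<forall>i<n. t i \<le> t (Suc i))}"

definition rectifiable_path :: "(real \<Rightarrow> 'a::real_normed_vector) \<Rightarrow> bool" where
  "rectifiable_path \<gamma> \<longleftrightarrow> path \<gamma> \<and> bdd_above (polygonal_sums \<gamma> 0 1)"

definition arc_length :: "(real \<Rightarrow> 'a::real_normed_vector) \<Rightarrow> real \<Rightarrow> real \<Rightarrow> real" where
  "arc_length \<gamma> a b = Sup (polygonal_sums \<gamma> a b)"

text \<open>The measure \<open>\<parallel>d\<gamma>\<parallel>\<close> is the Lebesgue--Stieltjes measure of the arc length function
  \<open>t \<mapsto> length (\<gamma> restricted to [0, t])\<close>, continued by constants outside \<open>[0, 1]\<close>. For a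
  rectifiable path (continuous by definition) this function is monotone and continuous,
  as \<^const>\<open>interval_measure\<close> needs.\<close>

definition arc_length_measure :: "(real \<Rightarrow> 'a::real_normed_vector) \<Rightarrow> real measure" where
  "arc_length_measure \<gamma> = interval_measure (\<lambda>t. arc_length \<gamma> 0 (max 0 (min 1 t)))"

section \<open>The quasihyperbolic metric\<close>

definition qh_length :: "'a::real_normed_vector set \<Rightarrow> (real \<Rightarrow> 'a) \<Rightarrow> real" where
  "qh_length \<Omega> \<gamma> =
     (LINT t:{0..1}|arc_length_measure \<gamma>. 1 / infdist (\<gamma> t) (frontier \<Omega>))"

definition qh_dist :: "'a::real_normed_vector set \<Rightarrow> 'a \<Rightarrow> 'a \<Rightarrow> real" where
  "qh_dist \<Omega> x y =
     Inf {qh_length \<Omega> \<gamma> | \<gamma>. rectifiable_path \<gamma> \<and> path_image \<gamma> \<subseteq> \<Omega>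
            \<and> pathstart \<gamma> = x \<and> pathfinish \<gamma> = y}"

definition qh_ball :: "'a::real_normed_vector set \<Rightarrow> 'a \<Rightarrow> real \<Rightarrow> 'a set" where
  "qh_ball \<Omega> a r = {u \<in> \<Omega>. qh_dist \<Omega> a u \<le> r}"

definition qh_sphere :: "'a::real_normed_vector set \<Rightarrow> 'a \<Rightarrow> real \<Rightarrow> 'a set" where
  "qh_sphere \<Omega> a r = {u \<in> \<Omega>. qh_dist \<Omega> a u = r}"

text \<open>\<open>T\<close> is the tangent space of the sphere with centre \<open>a\<close> and radius \<open>r\<close> at its point \<open>u\<close>.
  This is a relation rather than a function so that it cannot hold where \<open>k(a, \<cdot>)\<close> has no Frechet
  derivative; derivatives being unique, there is at most one such \<open>T\<close>.\<close>

definition is_qh_tangent_space ::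
  "'a::real_normed_vector set \<Rightarrow> 'a \<Rightarrow> real \<Rightarrow> 'a \<Rightarrow> 'a set \<Rightarrow> bool" where
  "is_qh_tangent_space \<Omega> a r u T \<longleftrightarrow> r > 0 \<and> u \<in> qh_sphere \<Omega> a r \<and>
     (\<exists>D. (qh_dist \<Omega> a has_derivative D) (at u) \<and> T = {u + h | h. D h = 0})"

end

theory Submission
  imports Defs
begin

text \<open>Write \<open>d\<close> for the distance to the boundary and \<open>f = k(x, \<cdot>)\<close>. The distance \<open>k(x, y)\<close> is
  approximated by \<open>\<kappa>\<close> times the least number of steps \<open>u \<rightarrow> v\<close> with \<open>\<parallel>u - v\<parallel> \<le> \<kappa> d(u)\<close> leading from
  \<open>x\<close> to \<open>y\<close>. On a convex domain \<open>d\<close> is concave, so two chains can be averaged step by step and \<open>f\<close> is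
  quasiconvex. Cutting a near-geodesic shortly before its endpoint \<open>w\<close> and replacing the rest by a
  segment shows that, by uniform smoothness, \<open>f\<close> is bounded above near \<open>w\<close> by an affine function with
  slope \<open>p / d(z)\<close>, \<open>p\<close> a support functional of the norm, up to \<open>e \<sigma>\<close> on the ball of radius \<open>\<sigma>\<close>,
  uniformly for \<open>w\<close> near \<open>z\<close>. Quasiconvexity forces all these functionals to be close to one another,
  across scales and base points; their limit is \<open>d(z)\<close> times the derivative of \<open>f\<close> at \<open>z\<close>, the lower
  bound on \<open>f(z + h)\<close> coming from the upper bound on \<open>f(z)\<close> based at \<open>w = z + h\<close>. The derivative is
  nonzero, and the inclusion of balls forces the derivatives of \<open>k(x, \<cdot>)\<close> and \<open>k(y, \<cdot>)\<close> at \<open>z\<close> to have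
  the same kernel.\<close>

section \<open>Arc length\<close>

lemma polygonal_sums_mono:
  assumes "a \<le> b" "c \<le> d"
  shows "polygonal_sums \<gamma> b c \<subseteq> polygonal_sums \<gamma> a d"
proof -
  have "{b..c} \<subseteq> {a..d}" using assms by auto
  then show ?thesis unfolding polygonal_sums_def by blast
qed

lemma polygonal_sums_bdd_mono:
  "bdd_above (polygonal_sums \<gamma> a d) \<Longrightarrow> a \<le> b \<Longrightarrow> c \<le> d \<Longrightarrow> bdd_above (polygonal_sums \<gamma> b c)"
  using polygonal_sums_mono bdd_above_mono by metis

lemma polygonal_sumsI:
  assumes "\<And>i. i \<le> n \<Longrightarrow> a \<le> t i \<and> t i \<le> b" "\<And>i. i < n \<Longrightarrow> t i \<le> t (Suc i)"
  shows "(\<Sum>i<n. norm (\<gamma> (t (Suc i)) - \<gamma> (t i))) \<in> polygonal_sums \<gamma> a b"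
  unfolding polygonal_sums_def using assms by auto

lemma polygonal_sumsE:
  assumes "S \<in> polygonal_sums \<gamma> a b"
  obtains n t where "S = (\<Sum>i<n. norm (\<gamma> (t (Suc i)) - \<gamma> (t i)))"
    "\<And>i. i \<le> n \<Longrightarrow> a \<le> t i" "\<And>i. i \<le> n \<Longrightarrow> t i \<le> b" "\<And>i. i < n \<Longrightarrow> t i \<le> t (Suc i)"
  using assms unfolding polygonal_sums_def by auto

lemma polygonal_sums_nonempty: "a \<le> b \<Longrightarrow> polygonal_sums \<gamma> a b \<noteq> {}"
  using polygonal_sumsI[of 0 a "\<lambda>_. a" b \<gamma>] by auto

lemma polygonal_sum_le_arc_length:
  assumes "bdd_above (polygonal_sums \<gamma> a b)"
    and "\<And>i. i \<le> n \<Longrightarrow> a \<le> t i \<and> t i \<le> b" "\<And>i. i < n \<Longrightarrow> t i \<le> t (Suc i)"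
  shows "(\<Sum>i<n. norm (\<gamma> (t (Suc i)) - \<gamma> (t i))) \<le> arc_length \<gamma> a b"
  unfolding arc_length_def by (intro cSup_upper polygonal_sumsI assms)

lemma arc_length_least:
  assumes "a \<le> b" "\<And>S. S \<in> polygonal_sums \<gamma> a b \<Longrightarrow> S \<le> C"
  shows "arc_length \<gamma> a b \<le> C"
  unfolding arc_length_def using assms polygonal_sums_nonempty by (intro cSup_least) auto

lemma norm_diff_le_arc_length:
  assumes "bdd_above (polygonal_sums \<gamma> a b)" "a \<le> b"
  shows "norm (\<gamma> b - \<gamma> a) \<le> arc_length \<gamma> a b"
  using polygonal_sum_le_arc_length[OF assms(1), of "Suc 0" "\<lambda>i. if i = 0 then a else b"] assms
  by simp

section \<open>Additivity of arc length\<close>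

lemma norm_diff_clamp:
  fixes \<gamma> :: "real \<Rightarrow> 'a::real_normed_vector"
  assumes "s \<le> s'"
  shows "norm (\<gamma> s' - \<gamma> s) \<le>
    norm (\<gamma> (min s' t) - \<gamma> (min s t)) + norm (\<gamma> (max s' t) - \<gamma> (max s t))"
proof -
  \<comment> \<open>An interval on one side of \<open>t\<close> is kept by one clamp and collapsed
    by the other; only an interval across \<open>t\<close> needs the triangle inequality.\<close>
  consider "s' \<le> t" | "t \<le> s" | "s < t" "t < s'" by linarith
  then show ?thesis
  proof cases
    case 3
    have "norm (\<gamma> s' - \<gamma> s) \<le> norm (\<gamma> t - \<gamma> s) + norm (\<gamma> s' - \<gamma> t)"
      using norm_triangle_ineq[of "\<gamma> t - \<gamma> s" "\<gamma> s' - \<gamma> t"] by simp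
    then show ?thesis using 3 by (simp add: min_def max_def)
  qed (use assms in \<open>simp_all add: min_def max_def\<close>)
qed

lemma polygonal_sum_clamp:
  fixes \<gamma> :: "real \<Rightarrow> 'a::real_normed_vector"
  assumes "\<And>i. i < n \<Longrightarrow> s i \<le> s (Suc i)"
  shows "(\<Sum>i<n. norm (\<gamma> (s (Suc i)) - \<gamma> (s i))) \<le>
    (\<Sum>i<n. norm (\<gamma> (min (s (Suc i)) t) - \<gamma> (min (s i) t))) +
    (\<Sum>i<n. norm (\<gamma> (max (s (Suc i)) t) - \<gamma> (max (s i) t)))"
  unfolding sum.distrib[symmetric] by (intro sum_mono norm_diff_clamp assms) auto

lemma arc_length_le_add:
  assumes "bdd_above (polygonal_sums \<gamma> a c)" "a \<le> b" "b \<le> c"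
  shows "arc_length \<gamma> a c \<le> arc_length \<gamma> a b + arc_length \<gamma> b c"
proof (rule arc_length_least)
  have bdd: "bdd_above (polygonal_sums \<gamma> a b)" "bdd_above (polygonal_sums \<gamma> b c)"
    using polygonal_sums_bdd_mono[OF assms(1)] assms by auto
  fix S assume "S \<in> polygonal_sums \<gamma> a c"
  then obtain n s where S: "S = (\<Sum>i<n. norm (\<gamma> (s (Suc i)) - \<gamma> (s i)))"
    and s: "\<And>i. i \<le> n \<Longrightarrow> a \<le> s i" "\<And>i. i \<le> n \<Longrightarrow> s i \<le> c" "\<And>i. i < n \<Longrightarrow> s i \<le> s (Suc i)"
    by (rule polygonal_sumsE) blast
  have "(\<Sum>i<n. norm (\<gamma> (min (s (Suc i)) b) - \<gamma> (min (s i) b))) \<le> arc_length \<gamma> a b"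
    by (rule polygonal_sum_le_arc_length[OF bdd(1)])
      (use assms s in \<open>force simp: min_le_iff_disj\<close>)+
  moreover have "(\<Sum>i<n. norm (\<gamma> (max (s (Suc i)) b) - \<gamma> (max (s i) b))) \<le> arc_length \<gamma> b c"
    by (rule polygonal_sum_le_arc_length[OF bdd(2)])
      (use assms s in \<open>force simp: le_max_iff_disj\<close>)+
  ultimately show "S \<le> arc_length \<gamma> a b + arc_length \<gamma> b c"
    using polygonal_sum_clamp[of n s \<gamma> b] s unfolding S by force
qed (use assms in auto)

lemma arc_length_add_le:
  assumes bdd: "bdd_above (polygonal_sums \<gamma> a c)" and "a \<le> b" "b \<le> c"
  shows "arc_length \<gamma> a b + arc_length \<gamma> b c \<le> arc_length \<gamma> a c"
proof -
  have add: "S + S' \<le> arc_length \<gamma> a c"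
    if "S \<in> polygonal_sums \<gamma> a b" "S' \<in> polygonal_sums \<gamma> b c" for S S'
  proof -
    obtain n s where S: "S = (\<Sum>i<n. norm (\<gamma> (s (Suc i)) - \<gamma> (s i)))"
      and s: "\<And>i. i \<le> n \<Longrightarrow> a \<le> s i" "\<And>i. i \<le> n \<Longrightarrow> s i \<le> b" "\<And>i. i < n \<Longrightarrow> s i \<le> s (Suc i)"
      using \<open>S \<in> polygonal_sums \<gamma> a b\<close> by (rule polygonal_sumsE) blast
    obtain m u where S': "S' = (\<Sum>i<m. norm (\<gamma> (u (Suc i)) - \<gamma> (u i)))"
      and u: "\<And>i. i \<le> m \<Longrightarrow> b \<le> u i" "\<And>i. i \<le> m \<Longrightarrow> u i \<le> c" "\<And>i. i < m \<Longrightarrow> u i \<le> u (Suc i)"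
      using \<open>S' \<in> polygonal_sums \<gamma> b c\<close> by (rule polygonal_sumsE) blast
    \<comment> \<open>Both \<open>s n\<close> and \<open>u 0\<close> are kept, so the concatenation
      has one extra increment, from \<open>s n \<le> b\<close> to \<open>u 0 \<ge> b\<close>. It is
      nonnegative and is dropped afterwards.\<close>
    define w where "w i = (if i \<le> n then s i else u (i - Suc n))" for i
    let ?f = "\<lambda>i. norm (\<gamma> (w (Suc i)) - \<gamma> (w i))"
    have "sum ?f {..<n} = S"
      unfolding S by (intro sum.cong) (auto simp: w_def)
    moreover have "sum ?f {Suc n..<Suc n + m} = S'"
      using sum.shift_bounds_nat_ivl[of ?f 0 "Suc n" m]
      by (simp add: S' w_def add.commute lessThan_atLeast0)
    moreover have "sum ?f {..<Suc n + m} = sum ?f {..<Suc n} + sum ?f {Suc n..<Suc n + m}"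
      using sum.atLeastLessThan_concat[of 0 "Suc n" "Suc n + m" ?f]
      by (simp only: lessThan_atLeast0)
    moreover have "sum ?f {..<n} \<le> sum ?f {..<Suc n}"
      by (rule sum_mono2) auto
    moreover have "sum ?f {..<Suc n + m} \<le> arc_length \<gamma> a c"
    proof (rule polygonal_sum_le_arc_length[OF bdd])
      show "a \<le> w i \<and> w i \<le> c" if "i \<le> Suc n + m" for i
      proof (cases "i \<le> n")
        case True
        then show ?thesis using s(1,2)[of i] assms by (simp add: w_def)
      next
        case False
        then have "i - Suc n \<le> m" using that by linarith
        then show ?thesis using u(1,2)[of "i - Suc n"] assms False by (simp add: w_def)
      qed
      show "w i \<le> w (Suc i)" if "i < Suc n + m" for i
      proof -
        consider "i < n" | "i = n" | "n < i" by linarith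
        then show ?thesis
        proof cases
          case 3
          then obtain k where "i = Suc n + k" by (auto simp: less_iff_Suc_add)
          then show ?thesis using u(3)[of k] that by (simp add: w_def)
        qed (use s(3)[of i] s(2)[of n] u(1)[of 0] in \<open>auto simp: w_def\<close>)
      qed
    qed
    ultimately show ?thesis by linarith
  qed
  then have *: "S \<le> arc_length \<gamma> a c - S'"
    if "S \<in> polygonal_sums \<gamma> a b" "S' \<in> polygonal_sums \<gamma> b c" for S S'
    using add[OF that] by simp
  have "S' \<le> arc_length \<gamma> a c - arc_length \<gamma> a b" if "S' \<in> polygonal_sums \<gamma> b c" for S'
    using arc_length_least[OF assms(2), of \<gamma> "arc_length \<gamma> a c - S'"] * that by force
  then show ?thesis
    using arc_length_least[OF assms(3), of \<gamma> "arc_length \<gamma> a c - arc_length \<gamma> a b"] by force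
qed

lemma arc_length_add:
  assumes "bdd_above (polygonal_sums \<gamma> a c)" "a \<le> b" "b \<le> c"
  shows "arc_length \<gamma> a b + arc_length \<gamma> b c = arc_length \<gamma> a c"
  using arc_length_add_le[OF assms] arc_length_le_add[OF assms] by linarith

lemma arc_length_nonneg:
  assumes "bdd_above (polygonal_sums \<gamma> a b)" "a \<le> b"
  shows "0 \<le> arc_length \<gamma> a b"
  using norm_diff_le_arc_length[OF assms] norm_ge_zero order_trans by blast

text \<open>A polygonal sum close to the total length has only finitely many increments. Clamped to
  \<open>[a, c]\<close> with \<open>c\<close> near \<open>a\<close> they are tiny, by continuity of
  the path at \<open>a\<close>. So nearly all of the length lies in \<open>[c, b]\<close>, and
  additivity leaves little for \<open>[a, c]\<close>.\<close>

lemma arc_length_right_small: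
  assumes bdd: "bdd_above (polygonal_sums \<gamma> a b)" and "a < b" "continuous_on {a..b} \<gamma>" "\<epsilon> > 0"
  shows "\<exists>c. a < c \<and> c \<le> b \<and> arc_length \<gamma> a c < \<epsilon>"
proof -
  obtain S where "S \<in> polygonal_sums \<gamma> a b" "arc_length \<gamma> a b - \<epsilon> / 2 < S"
    unfolding arc_length_def
    using less_cSup_iff[OF polygonal_sums_nonempty bdd, of "Sup (polygonal_sums \<gamma> a b) - \<epsilon> / 2"]
      assms by auto
  then obtain n s where S: "arc_length \<gamma> a b - \<epsilon> / 2 < (\<Sum>i<n. norm (\<gamma> (s (Suc i)) - \<gamma> (s i)))"
    and s: "\<And>i. i \<le> n \<Longrightarrow> a \<le> s i" "\<And>i. i \<le> n \<Longrightarrow> s i \<le> b" "\<And>i. i < n \<Longrightarrow> s i \<le> s (Suc i)"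
    by (elim polygonal_sumsE) blast
  \<comment> \<open>Each of the \<open>n\<close> clamped increments will be at most
    \<open>2 * e\<close>, in total at most \<open>\<epsilon> / 4\<close>.\<close>
  define e where "e = \<epsilon> / (8 * (real n + 1))"
  have "e > 0" using assms by (simp add: e_def)
  moreover have "a \<in> {a..b}" using assms(2) by simp
  ultimately obtain d where d: "d > 0" "\<And>u. u \<in> {a..b} \<Longrightarrow> dist u a < d \<Longrightarrow> dist (\<gamma> u) (\<gamma> a) < e"
    using assms(3) unfolding continuous_on_iff by blast
  define c where "c = min b (a + d / 2)"
  have c: "a < c" "c \<le> b" using assms(2) d(1) by (auto simp: c_def)
  have near: "norm (\<gamma> u - \<gamma> a) < e" if "a \<le> u" "u \<le> c" for u
  proof -
    have "dist u a < d" "u \<in> {a..b}" using that d(1) c unfolding c_def dist_real_def by auto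
    then show ?thesis using d(2) by (simp add: dist_norm)
  qed
  have "(\<Sum>i<n. norm (\<gamma> (min (s (Suc i)) c) - \<gamma> (min (s i) c))) \<le> (\<Sum>i<n. 2 * e)"
  proof (rule sum_mono)
    fix i assume "i \<in> {..<n}"
    then have "norm (\<gamma> (min (s (Suc i)) c) - \<gamma> a) < e" "norm (\<gamma> (min (s i) c) - \<gamma> a) < e"
      using s(1) c by (auto intro!: near)
    then show "norm (\<gamma> (min (s (Suc i)) c) - \<gamma> (min (s i) c)) \<le> 2 * e"
      using norm_triangle_ineq4[of "\<gamma> (min (s (Suc i)) c) - \<gamma> a" "\<gamma> (min (s i) c) - \<gamma> a"]
      by simp
  qed
  also have "\<dots> \<le> \<epsilon> / 4"
    using assms(4) by (simp add: e_def field_simps)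
  finally have 1: "(\<Sum>i<n. norm (\<gamma> (min (s (Suc i)) c) - \<gamma> (min (s i) c))) \<le> \<epsilon> / 4" .
  have "bdd_above (polygonal_sums \<gamma> c b)"
    using polygonal_sums_bdd_mono[OF bdd] c by auto
  then have 2: "(\<Sum>i<n. norm (\<gamma> (max (s (Suc i)) c) - \<gamma> (max (s i) c))) \<le> arc_length \<gamma> c b"
    by (rule polygonal_sum_le_arc_length) (use c s in \<open>force simp: le_max_iff_disj\<close>)+
  have "arc_length \<gamma> a c + arc_length \<gamma> c b = arc_length \<gamma> a b"
    using arc_length_add[OF bdd] c by auto
  then have "arc_length \<gamma> a c < \<epsilon>"
    using polygonal_sum_clamp[of n s \<gamma> c] s(3) S 1 2 assms(4) by fastforce
  then show ?thesis using c by blast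
qed

lemma polygonal_sum_le_lipschitz:
  assumes "a \<le> b" "\<And>s t. a \<le> s \<Longrightarrow> s \<le> t \<Longrightarrow> t \<le> b \<Longrightarrow> norm (\<gamma> t - \<gamma> s) \<le> C * (t - s)"
    and "S \<in> polygonal_sums \<gamma> a b"
  shows "S \<le> C * (b - a)"
proof -
  obtain n s where S: "S = (\<Sum>i<n. norm (\<gamma> (s (Suc i)) - \<gamma> (s i)))"
    and s: "\<And>i. i \<le> n \<Longrightarrow> a \<le> s i" "\<And>i. i \<le> n \<Longrightarrow> s i \<le> b" "\<And>i. i < n \<Longrightarrow> s i \<le> s (Suc i)"
    using assms(3) by (rule polygonal_sumsE) blast
  have "S \<le> (\<Sum>i<n. C * (s (Suc i) - s i))"
    unfolding S using s by (intro sum_mono assms(2)) auto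
  also have "\<dots> = C * (s n - s 0)"
    by (simp add: sum_distrib_left[symmetric] sum_lessThan_telescope)
  also have "\<dots> \<le> C * (b - a)"
  proof (cases "a = b")
    case True
    then show ?thesis using s(1,2)[of 0] s(1,2)[of n] by simp
  next
    case False
    have "0 \<le> norm (\<gamma> b - \<gamma> a)" by simp
    also have "\<dots> \<le> C * (b - a)" using assms by auto
    finally have "C \<ge> 0" using False assms(1) by (simp add: zero_le_mult_iff)
    then show ?thesis using s(1)[of 0] s(2)[of n] by (intro mult_left_mono) auto
  qed
  finally show ?thesis .
qed

subsection \<open>The arc length measure of a rectifiable path\<close>

definition arc_length_fun :: "(real \<Rightarrow> 'a::real_normed_vector) \<Rightarrow> real \<Rightarrow> real" where
  "arc_length_fun \<gamma> t = arc_length \<gamma> 0 (max 0 (min 1 t))"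

lemma rectifiable_path_bdd:
  "rectifiable_path \<gamma> \<Longrightarrow> 0 \<le> a \<Longrightarrow> b \<le> 1 \<Longrightarrow> bdd_above (polygonal_sums \<gamma> a b)"
  using polygonal_sums_bdd_mono[of \<gamma> 0 1 a b] unfolding rectifiable_path_def by simp

lemma arc_length_fun_diff:
  assumes "rectifiable_path \<gamma>" "0 \<le> a" "a \<le> b" "b \<le> 1"
  shows "arc_length_fun \<gamma> b - arc_length_fun \<gamma> a = arc_length \<gamma> a b"
  using arc_length_add[OF rectifiable_path_bdd[OF assms(1), of 0 b], of a] assms
  by (simp add: arc_length_fun_def)

lemma mono_arc_length_fun:
  assumes "rectifiable_path \<gamma>" "a \<le> b"
  shows "arc_length_fun \<gamma> a \<le> arc_length_fun \<gamma> b"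
proof -
  let ?c = "\<lambda>t::real. max 0 (min 1 t)"
  have "arc_length_fun \<gamma> t = arc_length_fun \<gamma> (?c t)" for t
    by (simp add: arc_length_fun_def)
  moreover have "?c a \<le> ?c b" using assms(2) by (simp add: max_def min_def)
  ultimately show ?thesis
    using arc_length_fun_diff[OF assms(1), of "?c a" "?c b"]
      arc_length_nonneg[OF rectifiable_path_bdd[OF assms(1)], of "?c a" "?c b"]
    by simp
qed

text \<open>On \<open>[0, 1)\<close> this comes from \<open>arc_length_right_small\<close> and
  monotonicity; elsewhere the function is constant just to the right of the point.\<close>

lemma arc_length_fun_right_continuous:
  assumes \<gamma>: "rectifiable_path \<gamma>"
  shows "continuous (at_right a) (arc_length_fun \<gamma>)"
proof (cases "0 \<le> a \<and> a < 1")
  case True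
  have "\<exists>d>0. arc_length_fun \<gamma> (a + d) - arc_length_fun \<gamma> a < \<epsilon>" if "\<epsilon> > 0" for \<epsilon>
  proof -
    have "continuous_on {a..1} \<gamma>"
      using \<gamma> True unfolding rectifiable_path_def path_def
      by (auto intro: continuous_on_subset)
    then obtain c where "a < c" "c \<le> 1" "arc_length \<gamma> a c < \<epsilon>"
      using arc_length_right_small[OF rectifiable_path_bdd[OF \<gamma>]] True \<open>\<epsilon> > 0\<close> by (metis order_refl)
    then show ?thesis
      using arc_length_fun_diff[OF \<gamma>, of a c] True by (intro exI[of _ "c - a"]) auto
  qed
  then show ?thesis
    by (intro continuous_at_right_real_increasing[THEN iffD2] mono_arc_length_fun \<gamma>) auto
next
  case False
  then have "\<forall>\<^sub>F t in at_right a. arc_length_fun \<gamma> t = arc_length_fun \<gamma> a"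
  proof (cases "a < 0")
    case True
    then show ?thesis
      unfolding eventually_at_right_field by (intro exI[of _ 0]) (auto simp: arc_length_fun_def)
  next
    case f: False
    then show ?thesis
      using False unfolding eventually_at_right_field
      by (intro exI[of _ "a + 1"]) (auto simp: arc_length_fun_def)
  qed
  then show ?thesis
    unfolding continuous_within by (simp add: tendsto_eventually)
qed

lemma arc_length_measure_eq: "arc_length_measure \<gamma> = interval_measure (arc_length_fun \<gamma>)"
  unfolding arc_length_measure_def arc_length_fun_def by simp

lemma sets_arc_length_measure [simp, measurable_cong]: "sets (arc_length_measure \<gamma>) = sets borel"
  by (simp add: arc_length_measure_eq)

lemma emeasure_arc_length_measure_Ioc:
  assumes "rectifiable_path \<gamma>" "a \<le> b"
  shows "emeasure (arc_length_measure \<gamma>) {a<..b} = ennreal (arc_length_fun \<gamma> b - arc_length_fun \<gamma> a)"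
  unfolding arc_length_measure_eq
  by (intro emeasure_interval_measure_Ioc mono_arc_length_fun arc_length_fun_right_continuous assms)

lemma emeasure_arc_length_measure_Ioc_eq:
  assumes "rectifiable_path \<gamma>" "0 \<le> a" "a \<le> b" "b \<le> 1"
  shows "emeasure (arc_length_measure \<gamma>) {a<..b} = ennreal (arc_length \<gamma> a b)"
  using assms by (simp add: emeasure_arc_length_measure_Ioc arc_length_fun_diff)

lemma emeasure_arc_length_measure_Icc_finite:
  assumes "rectifiable_path \<gamma>"
  shows "emeasure (arc_length_measure \<gamma>) {0..1} < \<infinity>"
proof -
  have "emeasure (arc_length_measure \<gamma>) {0..1} \<le> emeasure (arc_length_measure \<gamma>) {-1<..1}"
    by (intro emeasure_mono) auto
  also have "\<dots> < \<infinity>" by (simp add: emeasure_arc_length_measure_Ioc assms)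
  finally show ?thesis .
qed

text \<open>The arc length function is constant up to \<open>0\<close>, so the left endpoint carries
  no mass. Lengths can then be computed over half-open intervals, which fit together without
  overlap.\<close>

lemma null_arc_length_measure_0:
  assumes "rectifiable_path \<gamma>"
  shows "emeasure (arc_length_measure \<gamma>) {0} = 0"
proof -
  have "emeasure (arc_length_measure \<gamma>) {0} \<le> emeasure (arc_length_measure \<gamma>) {-1<..0}"
    by (intro emeasure_mono) auto
  also have "\<dots> = 0"
    by (simp add: emeasure_arc_length_measure_Ioc assms) (simp add: arc_length_fun_def)
  finally show ?thesis by simp
qed

section \<open>The quasihyperbolic distance in a convex domain\<close>

locale convex_domain =
  fixes \<Omega> :: "'a::real_normed_vector set"
  assumes nonempty: "\<Omega> \<noteq> {}" and proper: "\<Omega> \<noteq> UNIV"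
    and open_domain: "open \<Omega>" and convex: "convex \<Omega>"
begin

section \<open>The distance to the boundary and its concavity\<close>

abbreviation bd :: "'a \<Rightarrow> real" where
  "bd u \<equiv> infdist u (frontier \<Omega>)"

lemma frontier_nonempty: "frontier \<Omega> \<noteq> {}"
  using nonempty proper by (simp add: frontier_eq_empty)

lemma bd_pos: "u \<in> \<Omega> \<Longrightarrow> 0 < bd u"
  using frontier_nonempty open_domain frontier_disjoint_eq[of \<Omega>]
  by (intro infdist_pos_not_in_closed) auto

lemma bd_le: "bd u \<le> bd v + dist u v"
  by (rule infdist_triangle)

lemma ball_bd_subset: "u \<in> \<Omega> \<Longrightarrow> ball u (bd u) \<subseteq> \<Omega>"
proof (rule ccontr)
  assume u: "u \<in> \<Omega>" and "\<not> ball u (bd u) \<subseteq> \<Omega>"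
  then have "ball u (bd u) \<inter> frontier \<Omega> \<noteq> {}"
    using bd_pos[OF u] centre_in_ball[of u "bd u"] u by (intro connected_Int_frontier) blast+
  then obtain q where "q \<in> frontier \<Omega>" "dist u q < bd u" by auto
  then show False using infdist_le[of q "frontier \<Omega>" u] by auto
qed

lemma segment_in_domain: "u \<in> \<Omega> \<Longrightarrow> v \<in> \<Omega> \<Longrightarrow> 0 \<le> t \<Longrightarrow> t \<le> 1 \<Longrightarrow> (1 - t) *\<^sub>R u + t *\<^sub>R v \<in> \<Omega>"
  using convex unfolding convex_alt by blast

text \<open>The balls of radii \<open>bd u\<close> and \<open>bd v\<close> lie in the convex set,
  hence so does their average, the ball of radius \<open>(1 - t) * bd u + t * bd v\<close> about the
  averaged centre. An open set contains none of its frontier points, so this radius bounds the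
  distance from below.\<close>

lemma bd_concave:
  assumes "u \<in> \<Omega>" "v \<in> \<Omega>" "0 \<le> t" "t \<le> 1"
  shows "(1 - t) * bd u + t * bd v \<le> bd ((1 - t) *\<^sub>R u + t *\<^sub>R v)"
proof -
  define R where "R = (1 - t) * bd u + t * bd v"
  let ?m = "(1 - t) *\<^sub>R u + t *\<^sub>R v"
  have "R > 0"
  proof (cases "t = 0")
    case True
    then show ?thesis using bd_pos[OF assms(1)] by (simp add: R_def)
  next
    case False
    then have "0 < t * bd v" "0 \<le> (1 - t) * bd u" using bd_pos assms by (auto simp: less_imp_le)
    then show ?thesis by (simp add: R_def)
  qed
  have "R \<le> dist ?m q" if q: "q \<in> frontier \<Omega>" for q
  proof (rule ccontr)
    assume "\<not> R \<le> dist ?m q"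
    then have less: "norm (q - ?m) < R" by (simp add: dist_norm norm_minus_commute)
    \<comment> \<open>The position of \<open>q\<close> relative to the averaged ball; the same
      \<open>e\<close> picks a point in each of the two balls, and \<open>q\<close> is the average
      of these points.\<close>
    define e where "e = (1 / R) *\<^sub>R (q - ?m)"
    have "norm e < 1" using less \<open>R > 0\<close> by (simp add: e_def)
    have *: "w + bd w *\<^sub>R e \<in> \<Omega>" if "w \<in> \<Omega>" for w
    proof -
      have "bd w * norm e < bd w * 1"
        by (intro mult_strict_left_mono bd_pos that \<open>norm e < 1\<close>)
      then show ?thesis
        using ball_bd_subset[OF that] bd_pos[OF that] by (auto simp: subset_eq dist_norm)
    qed
    have "q = ?m + R *\<^sub>R e" using \<open>R > 0\<close> by (simp add: e_def)
    also have "\<dots> = (1 - t) *\<^sub>R (u + bd u *\<^sub>R e) + t *\<^sub>R (v + bd v *\<^sub>R e)"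
      by (simp add: R_def algebra_simps)
    also have "\<dots> \<in> \<Omega>" by (intro segment_in_domain * assms)
    finally have "q \<in> \<Omega>" .
    with q show False using open_domain frontier_disjoint_eq[of \<Omega>] by auto
  qed
  then show ?thesis
    unfolding R_def[symmetric] using frontier_nonempty
    by (simp add: infdist_notempty cINF_greatest)
qed

lemma bd_segment_ge_min:
  assumes "u \<in> \<Omega>" "v \<in> \<Omega>" "0 \<le> t" "t \<le> 1"
  shows "min (bd u) (bd v) \<le> bd ((1 - t) *\<^sub>R u + t *\<^sub>R v)"
proof -
  have "(1 - t) * min (bd u) (bd v) + t * min (bd u) (bd v) \<le> (1 - t) * bd u + t * bd v"
    using assms by (intro add_mono mult_left_mono) auto
  then show ?thesis using bd_concave[OF assms] by (simp add: algebra_simps)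
qed

subsection \<open>Quasihyperbolic length\<close>

text \<open>The integrand is continuous on a compact interval of finite measure. Without
  integrability the integral would default to 0 and say nothing about length.\<close>

lemma set_integrable_qh:
  assumes "rectifiable_path \<gamma>" "path_image \<gamma> \<subseteq> \<Omega>"
  shows "set_integrable (arc_length_measure \<gamma>) {0..1} (\<lambda>t. 1 / bd (\<gamma> t))"
proof -
  have cont: "continuous_on {0..1} (\<lambda>t. 1 / bd (\<gamma> t))"
  proof (intro continuous_intros)
    show "continuous_on {0..1} \<gamma>" using assms(1) by (simp add: rectifiable_path_def path_def)
    show "\<forall>t\<in>{0..1}. bd (\<gamma> t) \<noteq> 0"
    proof
      fix t :: real assume "t \<in> {0..1}"
      then have "\<gamma> t \<in> \<Omega>" using assms(2) by (auto simp: path_image_def)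
      then show "bd (\<gamma> t) \<noteq> 0" using bd_pos by fastforce
    qed
  qed
  then have "compact ((\<lambda>t. 1 / bd (\<gamma> t)) ` {0..1})"
    by (intro compact_continuous_image) auto
  then have "bounded ((\<lambda>t. 1 / bd (\<gamma> t)) ` {0..1})" by (rule compact_imp_bounded)
  then obtain C where C: "\<And>t. t \<in> {0..1} \<Longrightarrow> norm (1 / bd (\<gamma> t)) \<le> C"
    unfolding bounded_iff ball_simps by blast
  show ?thesis
    unfolding set_integrable_def
  proof (rule integrableI_bounded_set[where A="{0..1}" and B=C])
    show "(\<lambda>t. indicator {0..1} t *\<^sub>R (1 / bd (\<gamma> t))) \<in> borel_measurable (arc_length_measure \<gamma>)"
      using borel_measurable_continuous_on_indicator[OF _ cont]
      by (simp add: measurable_cong_sets[OF sets_arc_length_measure refl])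
    show "emeasure (arc_length_measure \<gamma>) {0..1} < \<infinity>"
      by (rule emeasure_arc_length_measure_Icc_finite[OF assms(1)])
  qed (use C in auto)
qed

lemma set_integrable_qh_Ioc:
  assumes "rectifiable_path \<gamma>" "path_image \<gamma> \<subseteq> \<Omega>" "0 \<le> a" "b \<le> 1"
  shows "set_integrable (arc_length_measure \<gamma>) {a<..b} (\<lambda>t. 1 / bd (\<gamma> t))"
  by (rule set_integrable_subset[OF set_integrable_qh[OF assms(1,2)]]) (use assms in auto)

lemma set_integral_nonneg_qh: "0 \<le> (LINT t:A|M. 1 / bd (\<gamma> t))"
  unfolding set_lebesgue_integral_def by (rule Bochner_Integration.integral_nonneg) (simp add: infdist_nonneg)

lemma qh_length_eq_Ioc:
  assumes "rectifiable_path \<gamma>" "path_image \<gamma> \<subseteq> \<Omega>"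
  shows "qh_length \<Omega> \<gamma> = (LINT t:{0<..1}|arc_length_measure \<gamma>. 1 / bd (\<gamma> t))"
proof -
  have "{0} \<in> null_sets (arc_length_measure \<gamma>)"
    using null_arc_length_measure_0[OF assms(1)] by (intro null_setsI) auto
  then have "AE t in arc_length_measure \<gamma>. t \<notin> {0}" by (rule AE_not_in)
  then have "AE t in arc_length_measure \<gamma>. (t \<in> {0..1}) = (t \<in> {0<..1})"
    by eventually_elim auto
  then show ?thesis
    unfolding qh_length_def using set_integrable_qh[OF assms] set_integrable_qh_Ioc[OF assms, of 0 1]
    by (intro set_integral_cong_set) (auto simp: set_borel_measurable_def set_integrable_def)
qed

lemma set_integral_qh_add:
  assumes "rectifiable_path \<gamma>" "path_image \<gamma> \<subseteq> \<Omega>" "0 \<le> a" "a \<le> b" "b \<le> c" "c \<le> 1"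
  shows "(LINT t:{a<..c}|arc_length_measure \<gamma>. 1 / bd (\<gamma> t)) =
    (LINT t:{a<..b}|arc_length_measure \<gamma>. 1 / bd (\<gamma> t)) +
    (LINT t:{b<..c}|arc_length_measure \<gamma>. 1 / bd (\<gamma> t))"
proof -
  have "{a<..c} = {a<..b} \<union> {b<..c}" using assms by auto
  then show ?thesis
    using set_integrable_qh_Ioc[OF assms(1,2), of a b] set_integrable_qh_Ioc[OF assms(1,2), of b c] assms
    by (simp add: set_integral_Un)
qed

lemma set_integral_const_Ioc:
  assumes "rectifiable_path \<gamma>" "0 \<le> a" "a \<le> b" "b \<le> 1"
  shows "(LINT t:{a<..b}|arc_length_measure \<gamma>. c) = arc_length \<gamma> a b * (c::real)"
    and "set_integrable (arc_length_measure \<gamma>) {a<..b} (\<lambda>_. c)"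
proof -
  note e = emeasure_arc_length_measure_Ioc_eq[OF assms]
  have "0 \<le> arc_length \<gamma> a b"
    by (intro arc_length_nonneg rectifiable_path_bdd assms)
  then have "measure (arc_length_measure \<gamma>) {a<..b} = arc_length \<gamma> a b"
    by (simp add: measure_def e)
  then show "(LINT t:{a<..b}|arc_length_measure \<gamma>. c) = arc_length \<gamma> a b * c"
    by (subst set_integral_const) (simp_all add: e)
  show "set_integrable (arc_length_measure \<gamma>) {a<..b} (\<lambda>_. c)"
    unfolding set_integrable_def by (intro integrable_scaleR_left) (simp_all add: e)
qed

lemma set_integral_qh_lower:
  assumes "rectifiable_path \<gamma>" "path_image \<gamma> \<subseteq> \<Omega>" "0 \<le> a" "a \<le> b" "b \<le> 1"
    and "\<And>t. a < t \<Longrightarrow> t \<le> b \<Longrightarrow> bd (\<gamma> t) \<le> M"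
  shows "arc_length \<gamma> a b / M \<le> (LINT t:{a<..b}|arc_length_measure \<gamma>. 1 / bd (\<gamma> t))"
proof -
  have "(LINT t:{a<..b}|arc_length_measure \<gamma>. 1 / M) \<le>
    (LINT t:{a<..b}|arc_length_measure \<gamma>. 1 / bd (\<gamma> t))"
  proof (intro set_integral_mono set_integral_const_Ioc set_integrable_qh_Ioc assms)
    fix t assume "t \<in> {a<..b}"
    then have "bd (\<gamma> t) \<le> M" "\<gamma> t \<in> \<Omega>"
      using assms(2-6) by (auto simp: path_image_def image_subset_iff)
    then have "bd (\<gamma> t) \<le> M" "0 < bd (\<gamma> t)" by (simp_all add: bd_pos)
    then show "1 / M \<le> 1 / bd (\<gamma> t)" by (simp add: frac_le)
  qed
  then show ?thesis using assms by (simp add: set_integral_const_Ioc)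
qed

lemma set_integral_qh_upper:
  assumes "rectifiable_path \<gamma>" "path_image \<gamma> \<subseteq> \<Omega>" "0 \<le> a" "a \<le> b" "b \<le> 1" "0 < m"
    and "\<And>t. a < t \<Longrightarrow> t \<le> b \<Longrightarrow> m \<le> bd (\<gamma> t)"
  shows "(LINT t:{a<..b}|arc_length_measure \<gamma>. 1 / bd (\<gamma> t)) \<le> arc_length \<gamma> a b / m"
proof -
  have "(LINT t:{a<..b}|arc_length_measure \<gamma>. 1 / bd (\<gamma> t)) \<le>
    (LINT t:{a<..b}|arc_length_measure \<gamma>. 1 / m)"
    by (intro set_integral_mono set_integral_const_Ioc set_integrable_qh_Ioc assms)
      (use assms in \<open>simp add: frac_le\<close>)
  then show ?thesis using assms by (simp add: set_integral_const_Ioc)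
qed

lemma qh_length_nonneg: "0 \<le> qh_length \<Omega> \<gamma>"
  unfolding qh_length_def by (rule set_integral_nonneg_qh)

lemma qh_dist_le_length:
  assumes "rectifiable_path \<gamma>" "path_image \<gamma> \<subseteq> \<Omega>" "pathstart \<gamma> = x" "pathfinish \<gamma> = y"
  shows "qh_dist \<Omega> x y \<le> qh_length \<Omega> \<gamma>"
  unfolding qh_dist_def
  by (rule cInf_lower) (use assms in \<open>auto intro!: bdd_belowI[of _ 0] qh_length_nonneg\<close>)

subsection \<open>Polygonal paths\<close>

text \<open>The path uses \<open>n\<close> equal parameter intervals and is linear on each. By
  concavity \<open>bd\<close> on a piece is at least its minimum at the two ends, which bounds the
  cost of the piece.\<close>

lemma polygonal_path:
  fixes p :: "nat \<Rightarrow> 'a"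
  assumes n: "n > 0" and p: "\<And>i. i \<le> n \<Longrightarrow> p i \<in> \<Omega>"
  shows "\<exists>\<gamma>. rectifiable_path \<gamma> \<and> path_image \<gamma> \<subseteq> \<Omega> \<and> pathstart \<gamma> = p 0 \<and> pathfinish \<gamma> = p n \<and>
    qh_length \<Omega> \<gamma> \<le> (\<Sum>i<n. dist (p i) (p (Suc i)) / min (bd (p i)) (bd (p (Suc i))))"
proof -
  \<comment> \<open>Clamping makes summand \<open>j\<close> vanish up to \<open>j / n\<close> and
    equal the whole edge from \<open>(j + 1) / n\<close> on, so a single formula gives the path and
    nothing has to be glued.\<close>
  define c :: "real \<Rightarrow> real" where "c y = max 0 (min 1 y)" for y
  define \<gamma> where "\<gamma> t = p 0 + (\<Sum>j<n. c (n * t - j) *\<^sub>R (p (Suc j) - p j))" for t :: real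
  have piece: "\<gamma> t = p i + (n * t - i) *\<^sub>R (p (Suc i) - p i)"
    if i: "i < n" "real i \<le> n * t" "n * t \<le> Suc i" for i and t :: real
  proof -
    have "(\<Sum>j<n. c (n * t - j) *\<^sub>R (p (Suc j) - p j)) = (\<Sum>j<Suc i. c (n * t - j) *\<^sub>R (p (Suc j) - p j))"
      using i by (intro sum.mono_neutral_right) (auto simp: c_def)
    also have "\<dots> = (\<Sum>j<i. c (n * t - j) *\<^sub>R (p (Suc j) - p j)) + (n * t - i) *\<^sub>R (p (Suc i) - p i)"
      using i by (simp add: c_def)
    also have "(\<Sum>j<i. c (n * t - j) *\<^sub>R (p (Suc j) - p j)) = (\<Sum>j<i. p (Suc j) - p j)"
      using i by (intro sum.cong) (auto simp: c_def)
    also have "\<dots> = p i - p 0" by (rule sum_lessThan_telescope)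
    finally show ?thesis by (simp add: \<gamma>_def)
  qed
  have index: "\<exists>i<n. real i \<le> n * t \<and> n * t \<le> Suc i" if "0 \<le> t" "t \<le> 1" for t :: real
  \<comment> \<open>At \<open>t = 1\<close> the floor of \<open>n * t\<close> would be
    \<open>n\<close>, one past the last piece.\<close>
  proof (cases "t = 1")
    case True
    then show ?thesis using n by (intro exI[of _ "n - 1"]) auto
  next
    case False
    then have "n * t < n" "0 \<le> n * t" using that n by auto
    then show ?thesis by (intro exI[of _ "nat \<lfloor>n * t\<rfloor>"]) (auto simp: nat_less_iff floor_less_iff; linarith)
  qed
  define C where "C = (\<Sum>j<n. n * norm (p (Suc j) - p j))"
  have lip: "norm (\<gamma> t - \<gamma> s) \<le> C * (t - s)" if "s \<le> t" for s t
  proof -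
    have "\<gamma> t - \<gamma> s = (\<Sum>j<n. (c (n * t - j) - c (n * s - j)) *\<^sub>R (p (Suc j) - p j))"
      by (simp add: \<gamma>_def sum_subtractf[symmetric] scaleR_left_diff_distrib)
    also have "norm \<dots> \<le> (\<Sum>j<n. n * (t - s) * norm (p (Suc j) - p j))"
    proof (rule sum_norm_le)
      fix j :: nat
      have "n * s \<le> n * t" using that by (simp add: mult_left_mono)
      then have "\<bar>c (n * t - j) - c (n * s - j)\<bar> \<le> n * (t - s)"
        by (auto simp: c_def algebra_simps max_def min_def)
      then show "norm ((c (n * t - j) - c (n * s - j)) *\<^sub>R (p (Suc j) - p j)) \<le> n * (t - s) * norm (p (Suc j) - p j)"
        by (simp add: mult_right_mono)
    qed
    finally show ?thesis by (simp add: C_def sum_distrib_left sum_distrib_right mult_ac)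
  qed
  have "continuous_on {0..1} \<gamma>"
    unfolding \<gamma>_def c_def by (intro continuous_intros)
  then have rect: "rectifiable_path \<gamma>"
    unfolding rectifiable_path_def path_def
    using polygonal_sum_le_lipschitz[of 0 1 \<gamma> C] lip by (auto intro!: bdd_aboveI[of _ "C * (1 - 0)"])
  have in_seg: "\<gamma> t \<in> \<Omega> \<and> min (bd (p i)) (bd (p (Suc i))) \<le> bd (\<gamma> t)"
    if i: "i < n" "real i \<le> n * t" "n * t \<le> Suc i" for i and t :: real
  proof -
    have "\<gamma> t = (1 - (n * t - i)) *\<^sub>R p i + (n * t - i) *\<^sub>R p (Suc i)"
      by (simp add: piece[OF i] algebra_simps)
    then show ?thesis
      using i segment_in_domain[OF p p, of i "Suc i" "n * t - i"] bd_segment_ge_min[OF p p, of i "Suc i" "n * t - i"]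
      by simp
  qed
  have image: "path_image \<gamma> \<subseteq> \<Omega>"
  proof
    fix v assume "v \<in> path_image \<gamma>"
    then obtain t where "0 \<le> t" "t \<le> 1" "v = \<gamma> t" by (auto simp: path_image_def)
    moreover from this obtain i where "i < n" "real i \<le> n * t" "n * t \<le> Suc i"
      using index by blast
    ultimately show "v \<in> \<Omega>" using in_seg by simp
  qed
  have start: "pathstart \<gamma> = p 0"
    using piece[of 0 0] n by (simp add: pathstart_def)
  have finish: "pathfinish \<gamma> = p n"
    using piece[of "n - 1" 1] n by (simp add: pathfinish_def of_nat_diff)
  have "k \<le> n \<Longrightarrow> (LINT t:{0<..k/n}|arc_length_measure \<gamma>. 1 / bd (\<gamma> t)) \<le>
      (\<Sum>i<k. dist (p i) (p (Suc i)) / min (bd (p i)) (bd (p (Suc i))))" for k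
  proof (induction k)
    case 0
    then show ?case by (simp add: set_lebesgue_integral_def)
  next
    case (Suc k)
    let ?m = "min (bd (p k)) (bd (p (Suc k)))"
    let ?a = "real k / n" and ?b = "real (Suc k) / n"
    have ab: "0 \<le> ?a" "?a \<le> ?b" "?b \<le> 1" using Suc n by (auto simp: divide_right_mono)
    have bounds: "real k \<le> n * t" "n * t \<le> Suc k" if "?a \<le> t" "t \<le> ?b" for t :: real
      using that n by (auto simp: field_simps)
    have "arc_length \<gamma> ?a ?b \<le> n * norm (p (Suc k) - p k) * (?b - ?a)"
    proof (intro arc_length_least polygonal_sum_le_lipschitz[of ?a ?b \<gamma>] ab)
      fix s t :: real assume st: "?a \<le> s" "s \<le> t" "t \<le> ?b"
      then have "\<gamma> t = p k + (n * t - k) *\<^sub>R (p (Suc k) - p k)"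
        "\<gamma> s = p k + (n * s - k) *\<^sub>R (p (Suc k) - p k)"
        using piece[of k t] piece[of k s] bounds[of t] bounds[of s] Suc.prems by auto
      then have "\<gamma> t - \<gamma> s = ((n * t - k) - (n * s - k)) *\<^sub>R (p (Suc k) - p k)"
        by (simp only: scaleR_left_diff_distrib add_diff_cancel_left)
      then have "\<gamma> t - \<gamma> s = (n * (t - s)) *\<^sub>R (p (Suc k) - p k)"
        by (simp add: right_diff_distrib)
      then show "norm (\<gamma> t - \<gamma> s) \<le> n * norm (p (Suc k) - p k) * (t - s)"
        using st by simp
    qed
    also have "\<dots> = dist (p k) (p (Suc k))"
      using n by (simp add: dist_norm norm_minus_commute diff_divide_distrib[symmetric])
    finally have len: "arc_length \<gamma> ?a ?b \<le> dist (p k) (p (Suc k))" .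
    have m: "0 < ?m" using Suc.prems p bd_pos by simp
    have "(LINT t:{?a<..?b}|arc_length_measure \<gamma>. 1 / bd (\<gamma> t)) \<le> arc_length \<gamma> ?a ?b / ?m"
      by (intro set_integral_qh_upper rect image ab m) (use in_seg bounds Suc.prems in auto)
    also have "\<dots> \<le> dist (p k) (p (Suc k)) / ?m"
      using len m by (intro divide_right_mono) auto
    finally show ?case
      using Suc set_integral_qh_add[OF rect image order_refl ab] by simp
  qed
  from this[of n] show ?thesis
    using rect image start finish n qh_length_eq_Ioc[OF rect image] by auto
qed

lemma qh_dist_polygonal:
  fixes p :: "nat \<Rightarrow> 'a"
  assumes "n > 0" "\<And>i. i \<le> n \<Longrightarrow> p i \<in> \<Omega>"
  shows "qh_dist \<Omega> (p 0) (p n) \<le> (\<Sum>i<n. dist (p i) (p (Suc i)) / min (bd (p i)) (bd (p (Suc i))))"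
proof -
  obtain \<gamma> where \<gamma>: "rectifiable_path \<gamma>" "path_image \<gamma> \<subseteq> \<Omega>" "pathstart \<gamma> = p 0" "pathfinish \<gamma> = p n"
    and len: "qh_length \<Omega> \<gamma> \<le> (\<Sum>i<n. dist (p i) (p (Suc i)) / min (bd (p i)) (bd (p (Suc i))))"
    using polygonal_path[of n p] assms by auto
  show ?thesis by (rule order_trans[OF qh_dist_le_length[OF \<gamma>] len])
qed

lemma obtain_near_minimizer:
  assumes "x \<in> \<Omega>" "y \<in> \<Omega>" "qh_dist \<Omega> x y < L"
  obtains \<gamma> where "rectifiable_path \<gamma>" "path_image \<gamma> \<subseteq> \<Omega>" "pathstart \<gamma> = x" "pathfinish \<gamma> = y"
    "qh_length \<Omega> \<gamma> < L"
proof -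
  let ?A = "{qh_length \<Omega> \<gamma> | \<gamma>. rectifiable_path \<gamma> \<and> path_image \<gamma> \<subseteq> \<Omega>
            \<and> pathstart \<gamma> = x \<and> pathfinish \<gamma> = y}"
  \<comment> \<open>\<open>Inf\<close> of an empty set of reals is unspecified, so an admissible
    path has to be exhibited; the straight segment serves, by convexity.\<close>
  obtain \<gamma> where "rectifiable_path \<gamma>" "path_image \<gamma> \<subseteq> \<Omega>" "pathstart \<gamma> = x" "pathfinish \<gamma> = y"
  proof -
    have "(if i = 0 then x else y) \<in> \<Omega>" for i :: nat using assms by simp
    then show thesis
      using polygonal_path[of 1 "\<lambda>i. if i = 0 then x else y"] that by auto
  qed
  then have "?A \<noteq> {}" by blast
  then obtain l where "l \<in> ?A" "l < L"
    using assms(3) cInf_lessD[of ?A L] unfolding qh_dist_def by auto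
  then show thesis using that by auto
qed

lemma qh_dist_nonneg:
  assumes "x \<in> \<Omega>" "y \<in> \<Omega>"
  shows "0 \<le> qh_dist \<Omega> x y"
proof (rule ccontr)
  assume "\<not> 0 \<le> qh_dist \<Omega> x y"
  then obtain \<gamma> where "qh_length \<Omega> \<gamma> < 0"
    using obtain_near_minimizer[OF assms, of 0] by auto
  then show False using qh_length_nonneg[of \<gamma>] by simp
qed

end

subsection \<open>Chains of small steps\<close>

text \<open>Estimates by chains have this shape: \<open>C\<close> plus the rounding of step counts,
  divided by the \<open>1 - \<kappa>\<close> of \<open>qh_dist_le_steps\<close>. Letting \<kappa>
  tend to 0 removes both losses.\<close>

lemma le_limit_small_steps:
  fixes q C \<kappa>\<^sub>0 :: real
  assumes "\<kappa>\<^sub>0 > 0" "\<And>\<kappa>. 0 < \<kappa> \<Longrightarrow> \<kappa> < \<kappa>\<^sub>0 \<Longrightarrow> \<kappa> < 1 \<Longrightarrow> q \<le> (C + 2 * \<kappa>) / (1 - \<kappa>)"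
  shows "q \<le> C"
proof -
  have "((\<lambda>\<kappa>. (C + 2 * \<kappa>) / (1 - \<kappa>)) \<longlongrightarrow> (C + 2 * 0) / (1 - 0)) (at_right 0)"
    by (intro tendsto_intros) auto
  then have lim: "((\<lambda>\<kappa>. (C + 2 * \<kappa>) / (1 - \<kappa>)) \<longlongrightarrow> C) (at_right 0)" by simp
  have ev: "\<forall>\<^sub>F \<kappa> in at_right 0. q \<le> (C + 2 * \<kappa>) / (1 - \<kappa>)"
    unfolding eventually_at_right_field
    by (rule exI[of _ "min \<kappa>\<^sub>0 1"]) (use assms in auto)
  show ?thesis
    by (rule tendsto_lowerbound[OF lim ev]) simp
qed

context convex_domain
begin

text \<open>A step has quasihyperbolic size about \<kappa>, so \<open>n * \<kappa>\<close> acts as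
  the length of a chain in \<open>steps \<kappa> ^^ n\<close>. It is measured against
  \<open>bd\<close> at its starting point alone, a condition that concavity makes stable under
  averaging.\<close>

definition steps :: "real \<Rightarrow> ('a \<times> 'a) set" where
  "steps \<kappa> = {(u, v). u \<in> \<Omega> \<and> v \<in> \<Omega> \<and> dist u v \<le> \<kappa> * bd u}"

lemma steps_refl: "u \<in> \<Omega> \<Longrightarrow> 0 < \<kappa> \<Longrightarrow> (u, u) \<in> steps \<kappa>"
  by (simp add: steps_def infdist_nonneg)

lemma steps_pow_refl: "u \<in> \<Omega> \<Longrightarrow> 0 < \<kappa> \<Longrightarrow> (u, u) \<in> steps \<kappa> ^^ n"
  by (induction n) (auto intro: steps_refl)

lemma steps_pow_domain: "(u, v) \<in> steps \<kappa> ^^ n \<Longrightarrow> u \<in> \<Omega> \<Longrightarrow> v \<in> \<Omega>"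
  by (cases n) (auto simp: steps_def)

lemma steps_pow_trans: "(u, v) \<in> steps \<kappa> ^^ m \<Longrightarrow> (v, w) \<in> steps \<kappa> ^^ n \<Longrightarrow> (u, w) \<in> steps \<kappa> ^^ (m + n)"
  by (auto simp: relpow_add)

text \<open>Standing still is a step, so chains can be padded and two of them brought to the same
  number of steps.\<close>

lemma steps_pow_mono:
  assumes "(u, v) \<in> steps \<kappa> ^^ m" "m \<le> n" "u \<in> \<Omega>" "0 < \<kappa>"
  shows "(u, v) \<in> steps \<kappa> ^^ n"
  using steps_pow_trans[OF assms(1) steps_pow_refl[of v \<kappa> "n - m"]] steps_pow_domain[OF assms(1)] assms
  by simp

lemma qh_dist_refl: "u \<in> \<Omega> \<Longrightarrow> qh_dist \<Omega> u u \<le> 0"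
  using qh_dist_polygonal[of 1 "\<lambda>_. u"] by simp

text \<open>Join consecutive points by segments. Over one step \<open>bd\<close> shrinks at most by
  the factor \<open>1 - \<kappa>\<close>, so each segment costs at most
  \<open>\<kappa> / (1 - \<kappa>)\<close>.\<close>

lemma qh_dist_le_steps:
  assumes "(u, v) \<in> steps \<kappa> ^^ n" "u \<in> \<Omega>" "0 < \<kappa>" "\<kappa> < 1"
  shows "qh_dist \<Omega> u v \<le> \<kappa> * n / (1 - \<kappa>)"
proof (cases "n = 0")
  case True
  then show ?thesis using assms qh_dist_refl by simp
next
  case False
  obtain p where p: "p 0 = u" "p n = v" "\<And>i. i < n \<Longrightarrow> (p i, p (Suc i)) \<in> steps \<kappa>"
    using assms(1) unfolding relpow_fun_conv by auto
  have "p i \<in> \<Omega>" if "i \<le> n" for i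
    using that p assms(2) by (cases i) (auto simp: steps_def Suc_le_eq)
  then have "qh_dist \<Omega> u v \<le> (\<Sum>i<n. dist (p i) (p (Suc i)) / min (bd (p i)) (bd (p (Suc i))))"
    using qh_dist_polygonal[of n p] False p by simp
  also have "\<dots> \<le> (\<Sum>i<n. \<kappa> / (1 - \<kappa>))"
  proof (rule sum_mono)
    fix i assume "i \<in> {..<n}"
    then have i: "p i \<in> \<Omega>" "dist (p i) (p (Suc i)) \<le> \<kappa> * bd (p i)"
      using p(3)[of i] by (auto simp: steps_def)
    define m where "m = min (bd (p i)) (bd (p (Suc i)))"
    have "bd (p i) \<le> bd (p (Suc i)) + \<kappa> * bd (p i)"
      using bd_le[of "p i" "p (Suc i)"] i by simp
    moreover have "0 \<le> \<kappa> * bd (p i)" using assms bd_pos[OF i(1)] by simp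
    ultimately have m: "(1 - \<kappa>) * bd (p i) \<le> m"
      by (simp add: algebra_simps m_def)
    have "0 < (1 - \<kappa>) * bd (p i)" using bd_pos[OF i(1)] assms by simp
    then have "0 < m" using m by linarith
    have "dist (p i) (p (Suc i)) \<le> \<kappa> / (1 - \<kappa>) * ((1 - \<kappa>) * bd (p i))"
      using i assms by simp
    also have "\<dots> \<le> \<kappa> / (1 - \<kappa>) * m"
      using m assms by (intro mult_left_mono) auto
    finally show "dist (p i) (p (Suc i)) / min (bd (p i)) (bd (p (Suc i))) \<le> \<kappa> / (1 - \<kappa>)"
      using \<open>0 < m\<close> unfolding m_def[symmetric] by (simp add: pos_divide_le_eq)
  qed
  finally show ?thesis by (simp add: mult.commute)
qed

text \<open>Each step runs up to the first exit from the ball of radius \<open>\<kappa> d(\<gamma>(s))\<close> about \<open>\<gamma>(s)\<close>, which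
  costs quasihyperbolic length at least \<open>\<kappa> / (1 + \<kappa>)\<close>.\<close>

lemma steps_along_path:
  assumes \<gamma>: "rectifiable_path \<gamma>" "path_image \<gamma> \<subseteq> \<Omega>" and "0 < \<kappa>"
  shows "0 \<le> s \<Longrightarrow> s \<le> 1 \<Longrightarrow>
    (LINT t:{s<..1}|arc_length_measure \<gamma>. 1 / bd (\<gamma> t)) < n * (\<kappa> / (1 + \<kappa>)) \<Longrightarrow>
    (\<gamma> s, \<gamma> 1) \<in> steps \<kappa> ^^ n"
proof (induction n arbitrary: s)
  case 0
  then show ?case
    using set_integral_nonneg_qh[of "arc_length_measure \<gamma>" "{s<..1}" \<gamma>] by simp
next
  case (Suc n)
  have in_dom: "\<gamma> t \<in> \<Omega>" if "0 \<le> t" "t \<le> 1" for t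
    using \<gamma>(2) that by (auto simp: path_image_def)
  define R where "R = \<kappa> * bd (\<gamma> s)"
  have R: "0 < R" using assms(3) bd_pos[OF in_dom] Suc.prems by (simp add: R_def)
  have cont: "continuous_on {s..1} (\<lambda>t. dist (\<gamma> s) (\<gamma> t))"
    using \<gamma>(1) Suc.prems unfolding rectifiable_path_def path_def
    by (intro continuous_intros) (auto intro: continuous_on_subset)
  show ?case
  \<comment> \<open>If the path stays in the ball to its end, one step reaches
    \<open>\<gamma> 1\<close> and the other \<open>n\<close> steps stand still.\<close>
  proof (cases "\<forall>t\<in>{s..1}. dist (\<gamma> s) (\<gamma> t) \<le> R")
    case True
    then have "(\<gamma> s, \<gamma> 1) \<in> steps \<kappa>"
      using Suc.prems in_dom by (auto simp: steps_def R_def)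
    then show ?thesis
      by (rule relpow_Suc_I2[OF _ steps_pow_refl[OF in_dom assms(3)]]) auto
  next
    case False
    \<comment> \<open>The first exit time is the least element of this compact set; the intermediate
      value theorem shows that the distance there is exactly \<open>R\<close>.\<close>
    define T where "T = {s..1} \<inter> (\<lambda>t. dist (\<gamma> s) (\<gamma> t)) -` {R..}"
    have "T \<noteq> {}" using False by (force simp: T_def)
    moreover have "closed T"
      unfolding T_def by (intro continuous_closed_preimage cont closed_atLeastAtMost closed_atLeast)
    then have "compact ({s..1} \<inter> T)" by (intro compact_Int_closed compact_Icc)
    then have "compact T" by (simp add: T_def)
    ultimately obtain t where t: "t \<in> T" "\<And>u. u \<in> T \<Longrightarrow> t \<le> u"
      using compact_attains_inf[of T] by auto
    have st: "s \<le> t" "t \<le> 1" "R \<le> dist (\<gamma> s) (\<gamma> t)" using t(1) by (auto simp: T_def)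
    have "continuous_on {s..t} (\<lambda>t. dist (\<gamma> s) (\<gamma> t))"
      using cont st by (auto intro: continuous_on_subset)
    then obtain u where u: "s \<le> u" "u \<le> t" "dist (\<gamma> s) (\<gamma> u) = R"
      using IVT'[of "\<lambda>t. dist (\<gamma> s) (\<gamma> t)" s R t] st R by auto
    then have "u \<in> T" using st by (auto simp: T_def)
    then have dist_t: "dist (\<gamma> s) (\<gamma> t) = R" using u t(2)[of u] by auto
    \<comment> \<open>Up to the exit \<open>bd\<close> exceeds \<open>bd (\<gamma> s)\<close> at
      most by the factor \<open>1 + \<kappa>\<close>, while the arc length is at least
      \<open>R\<close>; hence the cost of at least \<open>\<kappa> / (1 + \<kappa>)\<close>.\<close>
    have near: "bd (\<gamma> v) \<le> (1 + \<kappa>) * bd (\<gamma> s)" if "s \<le> v" "v \<le> t" for v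
    proof -
      have "dist (\<gamma> s) (\<gamma> v) \<le> R"
        using t(2)[of v] dist_t that st by (cases "v = t") (force simp: T_def)+
      then show ?thesis
        using bd_le[of "\<gamma> v" "\<gamma> s"] by (simp add: R_def dist_commute algebra_simps)
    qed
    have "R \<le> arc_length \<gamma> s t"
      using norm_diff_le_arc_length[OF rectifiable_path_bdd[OF \<gamma>(1)], of s t] dist_t st Suc.prems
      by (simp add: dist_norm norm_minus_commute)
    have bds: "0 < bd (\<gamma> s)" using bd_pos[OF in_dom] Suc.prems by simp
    have "\<kappa> / (1 + \<kappa>) = R / ((1 + \<kappa>) * bd (\<gamma> s))"
      using bds by (simp add: R_def)
    also have "\<dots> \<le> arc_length \<gamma> s t / ((1 + \<kappa>) * bd (\<gamma> s))"
      using \<open>R \<le> arc_length \<gamma> s t\<close> assms(3) bds by (intro divide_right_mono) auto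
    also have "\<dots> \<le> (LINT t:{s<..t}|arc_length_measure \<gamma>. 1 / bd (\<gamma> t))"
      using st Suc.prems near by (intro set_integral_qh_lower \<gamma>) auto
    finally have first: "\<kappa> / (1 + \<kappa>) \<le> (LINT t:{s<..t}|arc_length_measure \<gamma>. 1 / bd (\<gamma> t))" .
    have "real (Suc n) * (\<kappa> / (1 + \<kappa>)) = n * (\<kappa> / (1 + \<kappa>)) + \<kappa> / (1 + \<kappa>)"
      by (simp only: of_nat_Suc distrib_right mult_1_left)
    then have "(LINT t:{t<..1}|arc_length_measure \<gamma>. 1 / bd (\<gamma> t)) < n * (\<kappa> / (1 + \<kappa>))"
      using first set_integral_qh_add[OF \<gamma> Suc.prems(1) st(1,2)] Suc.prems(3) by linarith
    then have "(\<gamma> t, \<gamma> 1) \<in> steps \<kappa> ^^ n"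
      using Suc.IH[of t] st Suc.prems by auto
    moreover have "(\<gamma> s, \<gamma> t) \<in> steps \<kappa>"
      using dist_t in_dom[of s] in_dom[of t] st Suc.prems by (simp add: steps_def R_def)
    ultimately show ?thesis by (rule relpow_Suc_I2[rotated])
  qed
qed

lemma steps_of_qh_dist_less:
  assumes "u \<in> \<Omega>" "v \<in> \<Omega>" "qh_dist \<Omega> u v < L"
  obtains \<kappa>\<^sub>0 where "\<kappa>\<^sub>0 > 0"
    "\<And>\<kappa>. 0 < \<kappa> \<Longrightarrow> \<kappa> < \<kappa>\<^sub>0 \<Longrightarrow> \<exists>n. real n * \<kappa> \<le> L \<and> (u, v) \<in> steps \<kappa> ^^ n"
proof -
  obtain \<gamma> where \<gamma>: "rectifiable_path \<gamma>" "path_image \<gamma> \<subseteq> \<Omega>" "pathstart \<gamma> = u" "pathfinish \<gamma> = v"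
    and less: "qh_length \<Omega> \<gamma> < L"
    using obtain_near_minimizer[OF assms] .
  define l where "l = qh_length \<Omega> \<gamma>"
  have l: "0 \<le> l" "l < L" using less qh_length_nonneg by (auto simp: l_def)
  \<comment> \<open>The threshold is the condition \<open>l * (1 + \<kappa>) + \<kappa> < L\<close>
    solved for \<kappa>.\<close>
  have "\<exists>n. real n * \<kappa> \<le> L \<and> (u, v) \<in> steps \<kappa> ^^ n" if \<kappa>: "0 < \<kappa>" "\<kappa> < (L - l) / (l + 1)" for \<kappa>
  proof -
    define n where "n = Suc (nat \<lfloor>l * (1 + \<kappa>) / \<kappa>\<rfloor>)"
    have "0 \<le> l * (1 + \<kappa>) / \<kappa>" using l \<kappa> by simp
    then have n: "l * (1 + \<kappa>) / \<kappa> < n" "n \<le> l * (1 + \<kappa>) / \<kappa> + 1"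
      unfolding n_def by linarith+
    have "l < n * (\<kappa> / (1 + \<kappa>))"
      using n(1) \<kappa> by (simp add: field_simps)
    then have "(\<gamma> 0, \<gamma> 1) \<in> steps \<kappa> ^^ n"
      using \<kappa>(1) by (intro steps_along_path \<gamma>) (auto simp: l_def qh_length_eq_Ioc[OF \<gamma>(1,2)])
    moreover have "n * \<kappa> \<le> l * (1 + \<kappa>) + \<kappa>"
      using mult_right_mono[OF n(2), of \<kappa>] \<kappa> by (simp add: distrib_right)
    moreover have "\<kappa> * (l + 1) < L - l"
      using \<kappa>(2) l(1) by (simp add: pos_less_divide_eq)
    ultimately show ?thesis
      using \<gamma>(3,4) by (intro exI[of _ n]) (auto simp: pathstart_def pathfinish_def algebra_simps)
  qed
  moreover have "0 < (L - l) / (l + 1)" using l by simp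
  ultimately show thesis by (rule that[rotated])
qed

text \<open>Cut the segment into \<open>n\<close> equal parts of length at most
  \<open>\<kappa> * m\<close>. Since \<open>bd\<close> is at least \<open>m\<close> all along the
  segment, each part is a step; rounding \<open>n\<close> up costs at most \<kappa>.\<close>

lemma steps_segment:
  assumes "u \<in> \<Omega>" "v \<in> \<Omega>" "0 < m" "m \<le> bd u" "m \<le> bd v" "0 < \<kappa>"
  shows "\<exists>n. real n * \<kappa> \<le> dist u v / m + 2 * \<kappa> \<and> (u, v) \<in> steps \<kappa> ^^ n"
proof -
  define n where "n = Suc (nat \<lfloor>dist u v / (m * \<kappa>)\<rfloor>)"
  have "0 \<le> dist u v / (m * \<kappa>)" using assms by simp
  then have n: "dist u v / (m * \<kappa>) < n" "n \<le> dist u v / (m * \<kappa>) + 1"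
    unfolding n_def by linarith+
  have n0: "0 < n" by (simp add: n_def)
  define p where "p i = (1 - real i / n) *\<^sub>R u + (real i / n) *\<^sub>R v" for i
  have "(p i, p (Suc i)) \<in> steps \<kappa>" if "i < n" for i
  proof -
    have frac: "0 \<le> real i / n" "real i / n \<le> 1" "0 \<le> real (Suc i) / n" "real (Suc i) / n \<le> 1"
      using that by (auto simp: divide_le_eq)
    have diff: "p (Suc i) - p i = (1 / n) *\<^sub>R (v - u)"
      by (simp add: p_def add_divide_distrib algebra_simps)
    have "dist (p i) (p (Suc i)) = norm (p (Suc i) - p i)"
      by (simp add: dist_norm norm_minus_commute)
    also have "\<dots> = dist u v / n"
      by (simp add: diff dist_norm norm_minus_commute)
    finally have "dist (p i) (p (Suc i)) = dist u v / n" .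
    also have "\<dots> \<le> \<kappa> * m"
      using n(1) n0 assms by (simp add: field_simps)
    also have "\<dots> \<le> \<kappa> * bd (p i)"
      using bd_segment_ge_min[OF assms(1,2) frac(1,2)] assms by (intro mult_left_mono) (auto simp: p_def)
    finally show ?thesis
      using segment_in_domain[OF assms(1,2)] frac by (simp add: steps_def p_def)
  qed
  moreover have "p 0 = u" "p n = v" using n0 by (simp_all add: p_def)
  ultimately have "(u, v) \<in> steps \<kappa> ^^ n" unfolding relpow_fun_conv by blast
  moreover have "n * \<kappa> \<le> dist u v / m + 2 * \<kappa>"
    using mult_right_mono[OF n(2), of \<kappa>] assms by (simp add: distrib_right)
  ultimately show ?thesis by blast
qed

text \<open>A near-optimal chain to \<open>u\<close> is continued by a chain along the segment,
  which yields this triangle inequality without concatenating rectifiable paths.\<close>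

lemma qh_dist_segment:
  assumes "x \<in> \<Omega>" "u \<in> \<Omega>" "v \<in> \<Omega>" "0 < m" "m \<le> bd u" "m \<le> bd v"
  shows "qh_dist \<Omega> x v \<le> qh_dist \<Omega> x u + dist u v / m"
proof (rule field_le_epsilon)
  fix \<epsilon> :: real assume "0 < \<epsilon>"
  then obtain \<kappa>\<^sub>0 where "\<kappa>\<^sub>0 > 0" and \<kappa>\<^sub>0: "\<And>\<kappa>. 0 < \<kappa> \<Longrightarrow> \<kappa> < \<kappa>\<^sub>0 \<Longrightarrow>
      \<exists>n. real n * \<kappa> \<le> qh_dist \<Omega> x u + \<epsilon> \<and> (x, u) \<in> steps \<kappa> ^^ n"
    using steps_of_qh_dist_less[OF assms(1,2), of "qh_dist \<Omega> x u + \<epsilon>"] by auto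
  have "qh_dist \<Omega> x v \<le> qh_dist \<Omega> x u + \<epsilon> + dist u v / m"
  proof (rule le_limit_small_steps[OF \<open>\<kappa>\<^sub>0 > 0\<close>])
    fix \<kappa> assume \<kappa>: "0 < \<kappa>" "\<kappa> < \<kappa>\<^sub>0" "\<kappa> < 1"
    obtain n where n: "real n * \<kappa> \<le> qh_dist \<Omega> x u + \<epsilon>" "(x, u) \<in> steps \<kappa> ^^ n"
      using \<kappa>\<^sub>0 \<kappa> by blast
    obtain k where k: "real k * \<kappa> \<le> dist u v / m + 2 * \<kappa>" "(u, v) \<in> steps \<kappa> ^^ k"
      using steps_segment[OF assms(2-6) \<kappa>(1)] by blast
    have "qh_dist \<Omega> x v \<le> \<kappa> * real (n + k) / (1 - \<kappa>)"
      by (rule qh_dist_le_steps[OF steps_pow_trans[OF n(2) k(2)] assms(1) \<kappa>(1,3)])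
    also have "\<dots> \<le> (qh_dist \<Omega> x u + \<epsilon> + dist u v / m + 2 * \<kappa>) / (1 - \<kappa>)"
      using n k \<kappa> by (intro divide_right_mono) (auto simp: algebra_simps)
    finally show "qh_dist \<Omega> x v \<le> (qh_dist \<Omega> x u + \<epsilon> + dist u v / m + 2 * \<kappa>) / (1 - \<kappa>)" .
  qed
  then show "qh_dist \<Omega> x v \<le> qh_dist \<Omega> x u + dist u v / m + \<epsilon>" by simp
qed

section \<open>Averaging of chains and quasiconvexity of the distance\<close>

lemma steps_pow_convex:
  assumes "0 \<le> t" "t \<le> 1" "0 < \<kappa>"
  shows "(x, a) \<in> steps \<kappa> ^^ n \<Longrightarrow> (y, b) \<in> steps \<kappa> ^^ n \<Longrightarrow>
    ((1 - t) *\<^sub>R x + t *\<^sub>R y, (1 - t) *\<^sub>R a + t *\<^sub>R b) \<in> steps \<kappa> ^^ n"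
proof (induction n arbitrary: a b)
  case (Suc n)
  obtain u where u: "(x, u) \<in> steps \<kappa> ^^ n" "(u, a) \<in> steps \<kappa>" using Suc.prems(1) by auto
  obtain v where v: "(y, v) \<in> steps \<kappa> ^^ n" "(v, b) \<in> steps \<kappa>" using Suc.prems(2) by auto
  have dom: "u \<in> \<Omega>" "a \<in> \<Omega>" "v \<in> \<Omega>" "b \<in> \<Omega>"
    and le: "dist u a \<le> \<kappa> * bd u" "dist v b \<le> \<kappa> * bd v"
    using u v by (auto simp: steps_def)
  let ?c = "\<lambda>u v :: 'a. (1 - t) *\<^sub>R u + t *\<^sub>R v"
  \<comment> \<open>The averaged displacement is at most \<kappa> times the averaged
    \<open>bd\<close>, and by concavity this is at most \<kappa> times \<open>bd\<close> at the
    averaged point.\<close>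
  have "?c u v - ?c a b = (1 - t) *\<^sub>R (u - a) + t *\<^sub>R (v - b)" by (simp add: algebra_simps)
  then have "dist (?c u v) (?c a b) \<le> (1 - t) * dist u a + t * dist v b"
    using norm_triangle_ineq[of "(1 - t) *\<^sub>R (u - a)" "t *\<^sub>R (v - b)"] assms by (simp add: dist_norm)
  also have "\<dots> \<le> (1 - t) * (\<kappa> * bd u) + t * (\<kappa> * bd v)"
    using le assms by (intro add_mono mult_left_mono) auto
  also have "\<dots> = \<kappa> * ((1 - t) * bd u + t * bd v)" by (simp add: algebra_simps)
  also have "\<dots> \<le> \<kappa> * bd (?c u v)"
    using bd_concave dom assms by (intro mult_left_mono) auto
  finally have "(?c u v, ?c a b) \<in> steps \<kappa>"
    using segment_in_domain dom assms by (simp add: steps_def)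
  then show ?case using Suc.IH[OF u(1) v(1)] by auto
qed simp

lemma qh_dist_quasiconvex:
  assumes "x \<in> \<Omega>" "u \<in> \<Omega>" "v \<in> \<Omega>" "0 \<le> t" "t \<le> 1"
    and "qh_dist \<Omega> x u \<le> C" "qh_dist \<Omega> x v \<le> C"
  shows "qh_dist \<Omega> x ((1 - t) *\<^sub>R u + t *\<^sub>R v) \<le> C"
proof (rule field_le_epsilon)
  fix \<epsilon> :: real assume \<epsilon>: "0 < \<epsilon>"
  then have less: "qh_dist \<Omega> x u < C + \<epsilon>" "qh_dist \<Omega> x v < C + \<epsilon>" using assms by auto
  obtain \<kappa>\<^sub>1 where "\<kappa>\<^sub>1 > 0" and \<kappa>\<^sub>1: "\<And>\<kappa>. 0 < \<kappa> \<Longrightarrow> \<kappa> < \<kappa>\<^sub>1 \<Longrightarrow>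
      \<exists>n. real n * \<kappa> \<le> C + \<epsilon> \<and> (x, u) \<in> steps \<kappa> ^^ n"
    using steps_of_qh_dist_less[OF assms(1,2) less(1)] by auto
  obtain \<kappa>\<^sub>2 where "\<kappa>\<^sub>2 > 0" and \<kappa>\<^sub>2: "\<And>\<kappa>. 0 < \<kappa> \<Longrightarrow> \<kappa> < \<kappa>\<^sub>2 \<Longrightarrow>
      \<exists>n. real n * \<kappa> \<le> C + \<epsilon> \<and> (x, v) \<in> steps \<kappa> ^^ n"
    using steps_of_qh_dist_less[OF assms(1,3) less(2)] by auto
  have "0 < min \<kappa>\<^sub>1 \<kappa>\<^sub>2" using \<open>\<kappa>\<^sub>1 > 0\<close> \<open>\<kappa>\<^sub>2 > 0\<close> by simp
  then show "qh_dist \<Omega> x ((1 - t) *\<^sub>R u + t *\<^sub>R v) \<le> C + \<epsilon>"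
  proof (rule le_limit_small_steps)
    fix \<kappa> assume \<kappa>: "0 < \<kappa>" "\<kappa> < min \<kappa>\<^sub>1 \<kappa>\<^sub>2" "\<kappa> < 1"
    obtain n where n: "real n * \<kappa> \<le> C + \<epsilon>" "(x, u) \<in> steps \<kappa> ^^ n" using \<kappa>\<^sub>1[of \<kappa>] \<kappa> by auto
    obtain k where k: "real k * \<kappa> \<le> C + \<epsilon>" "(x, v) \<in> steps \<kappa> ^^ k" using \<kappa>\<^sub>2[of \<kappa>] \<kappa> by auto
    \<comment> \<open>Chains of equal length can be averaged step by step, and the average starts at
      \<open>x\<close> again.\<close>
    have "(x, u) \<in> steps \<kappa> ^^ max n k" "(x, v) \<in> steps \<kappa> ^^ max n k"
      using steps_pow_mono n k assms(1) \<kappa>(1) by auto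
    then have "(x, (1 - t) *\<^sub>R u + t *\<^sub>R v) \<in> steps \<kappa> ^^ max n k"
      using steps_pow_convex[OF assms(4,5) \<kappa>(1), of x u "max n k" x v] by (simp add: algebra_simps)
    then have "qh_dist \<Omega> x ((1 - t) *\<^sub>R u + t *\<^sub>R v) \<le> \<kappa> * real (max n k) / (1 - \<kappa>)"
      by (rule qh_dist_le_steps[OF _ assms(1) \<kappa>(1,3)])
    also have "\<dots> \<le> (C + \<epsilon> + 2 * \<kappa>) / (1 - \<kappa>)"
      using n k \<kappa> by (intro divide_right_mono) (auto simp: max_def mult.commute)
    finally show "qh_dist \<Omega> x ((1 - t) *\<^sub>R u + t *\<^sub>R v) \<le> (C + \<epsilon> + 2 * \<kappa>) / (1 - \<kappa>)" .
  qed
qed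

text \<open>The point \<open>u\<close> is the last one of the chain at distance at least \<tau> from
  \<open>w\<close>; the \<open>j\<close> steps from \<open>u\<close> on start at distance at most
  \<open>dist u w\<close>, so each has length at most \<open>\<kappa> * (bd w + dist u w)\<close>.
  The second alternative covers chains with no such point. The induction prepends steps, reading the
  chain backwards from \<open>w\<close>.\<close>

lemma steps_last_exit:
  assumes "0 < \<kappa>" "\<kappa> \<le> 1 / 2" "\<kappa> * bd w \<le> \<tau> / 2" "0 < \<tau>"
  shows "(x, w) \<in> steps \<kappa> ^^ n \<Longrightarrow> x \<in> \<Omega> \<Longrightarrow>
    (\<exists>u m j. m + j \<le> n \<and> (x, u) \<in> steps \<kappa> ^^ m \<and> \<tau> \<le> dist u w \<and> dist u w \<le> 3 * \<tau> \<and>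
      dist u w \<le> \<kappa> * real j * (bd w + dist u w))
    \<or> dist x w < \<tau> \<and> dist x w \<le> \<kappa> * real n * (bd w + \<tau>)"
    (is "_ \<Longrightarrow> _ \<Longrightarrow> ?A n x \<or> ?B n x")
proof (induction n arbitrary: x)
  case 0
  then show ?case using assms by simp
next
  case (Suc n)
  obtain y where y: "(x, y) \<in> steps \<kappa>" "(y, w) \<in> steps \<kappa> ^^ n"
    using relpow_Suc_D2[OF Suc.prems(1)] by blast
  then have "y \<in> \<Omega>" "dist x y \<le> \<kappa> * bd x" by (auto simp: steps_def)
  from Suc.IH[OF y(2) this(1)] show ?case
  proof
    assume "?A n y"
    then obtain u m j where u: "m + j \<le> n" "(y, u) \<in> steps \<kappa> ^^ m" "\<tau> \<le> dist u w" "dist u w \<le> 3 * \<tau>"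
      "dist u w \<le> \<kappa> * real j * (bd w + dist u w)"
      by blast
    then have "(x, u) \<in> steps \<kappa> ^^ Suc m" using y(1) relpow_Suc_I2 by metis
    then have "?A (Suc n) x" using u by (intro exI[of _ u] exI[of _ "Suc m"] exI[of _ j]) simp
    then show ?thesis ..
  next
    assume B: "?B n y"
    have tri: "dist x w \<le> \<kappa> * bd x + dist y w"
      using \<open>dist x y \<le> \<kappa> * bd x\<close> dist_triangle[of x w y] by linarith
    have bdx: "\<kappa> * bd x \<le> \<kappa> * (bd w + dist x w)"
      using bd_le[of x w] assms by (intro mult_left_mono) auto
    show ?thesis
    proof (cases "dist x w < \<tau>")
      case True
      have "\<kappa> * (bd w + dist x w) \<le> \<kappa> * (bd w + \<tau>)"
        using True assms by (intro mult_left_mono) auto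
      then have "dist x w \<le> \<kappa> * (bd w + \<tau>) + \<kappa> * real n * (bd w + \<tau>)"
        using tri bdx B by linarith
      then show ?thesis using True by (simp add: algebra_simps)
    next
      case False
      have "\<kappa> * real n * (bd w + \<tau>) \<le> \<kappa> * real n * (bd w + dist x w)"
        using False assms by (intro mult_left_mono) auto
      then have "dist x w \<le> \<kappa> * (bd w + dist x w) + \<kappa> * real n * (bd w + dist x w)"
        using tri bdx B by linarith
      then have "dist x w \<le> \<kappa> * real (Suc n) * (bd w + dist x w)"
        by (simp add: algebra_simps)
      \<comment> \<open>Half of \<open>dist x w\<close> is absorbed, and the bound
        \<open>\<tau> / 2 + \<tau>\<close> on the other half gives
        \<open>3 * \<tau>\<close>.\<close>
      moreover have "\<kappa> * dist x w \<le> 1 / 2 * dist x w"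
        using assms by (intro mult_right_mono) auto
      then have "dist x w \<le> 3 * \<tau>"
        using tri bdx B assms(3) by (simp add: distrib_left)
      ultimately have "?A (Suc n) x"
        using False by (intro exI[of _ x] exI[of _ 0] exI[of _ "Suc n"]) simp
      then show ?thesis ..
    qed
  qed
qed

text \<open>Cut a nearly optimal chain at its last exit from the ball of radius \<tau>. Its tail
  uses up \<open>\<kappa> * j\<close> of the length, at least
  \<open>dist u w / (bd w + dist u w)\<close>, and this much is saved at \<open>u\<close>.\<close>

lemma near_geodesic_point:
  assumes "x \<in> \<Omega>" "w \<in> \<Omega>" "0 < \<tau>" "\<tau> \<le> dist x w" "0 < \<eta>"
  obtains u where "u \<in> \<Omega>" "\<tau> \<le> dist u w" "dist u w \<le> 3 * \<tau>"
    "qh_dist \<Omega> x u \<le> qh_dist \<Omega> x w + \<eta> - dist u w / (bd w + dist u w)"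
proof -
  define L where "L = qh_dist \<Omega> x w + \<eta> / 2"
  have L: "0 < L" using qh_dist_nonneg assms by (force simp: L_def)
  have "qh_dist \<Omega> x w < L" using assms by (simp add: L_def)
  then obtain \<kappa>\<^sub>0 where \<kappa>\<^sub>0: "\<kappa>\<^sub>0 > 0" "\<And>\<kappa>. 0 < \<kappa> \<Longrightarrow> \<kappa> < \<kappa>\<^sub>0 \<Longrightarrow>
      \<exists>n. real n * \<kappa> \<le> L \<and> (x, w) \<in> steps \<kappa> ^^ n"
    using steps_of_qh_dist_less[OF assms(1,2)] by metis
  \<comment> \<open>The bounds serve, in turn, the existence of the chain, the estimate of
    \<open>1 / (1 - \<kappa>)\<close> by \<open>1 + 2 * \<kappa>\<close>, the step size near
    \<open>w\<close>, and keeping the loss \<open>2 * \<kappa> * L\<close> in that estimate at most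
    \<open>\<eta> / 2\<close>.\<close>
  define \<kappa> where "\<kappa> = min (min (\<kappa>\<^sub>0 / 2) (1 / 2)) (min (\<tau> / (2 * bd w)) (\<eta> / (4 * L)))"
  have bdw: "0 < bd w" by (rule bd_pos[OF assms(2)])
  have \<kappa>: "0 < \<kappa>" "\<kappa> < \<kappa>\<^sub>0" "\<kappa> \<le> 1 / 2"
    using \<kappa>\<^sub>0(1) bdw L assms by (auto simp: \<kappa>_def min_less_iff_disj)
  have "\<kappa> \<le> \<tau> / (2 * bd w)" "\<kappa> \<le> \<eta> / (4 * L)" by (auto simp: \<kappa>_def)
  then have \<kappa>': "\<kappa> * bd w \<le> \<tau> / 2" "2 * \<kappa> * L \<le> \<eta> / 2"
    using bdw L by (auto simp: field_simps)
  obtain n where n: "real n * \<kappa> \<le> L" "(x, w) \<in> steps \<kappa> ^^ n" using \<kappa>\<^sub>0(2) \<kappa> by blast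
  obtain u m j where u: "m + j \<le> n" "(x, u) \<in> steps \<kappa> ^^ m" "\<tau> \<le> dist u w" "dist u w \<le> 3 * \<tau>"
      "dist u w \<le> \<kappa> * real j * (bd w + dist u w)"
    using steps_last_exit[OF \<kappa>(1,3) \<kappa>'(1) assms(3) n(2) assms(1)] assms(4) by auto
  have "0 < bd w + dist u w" using bdw by (simp add: add_pos_nonneg)
  then have "dist u w / (bd w + dist u w) \<le> \<kappa> * real j"
    using u(5) by (simp add: pos_divide_le_eq)
  moreover have "\<kappa> * real (m + j) \<le> \<kappa> * real n"
    using u(1) \<kappa>(1) by (intro mult_left_mono) auto
  ultimately have X: "\<kappa> * real m \<le> L - dist u w / (bd w + dist u w)"
    using n(1) by (simp add: algebra_simps)
  define X where "X = \<kappa> * real m"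
  have "0 \<le> dist u w / (bd w + dist u w)" using bdw by (simp add: add_nonneg_nonneg)
  then have "0 \<le> X" "X \<le> L" using X \<kappa>(1) unfolding X_def by auto
  have "X / (1 - \<kappa>) \<le> X * (1 + 2 * \<kappa>)"
  proof -
    have "0 \<le> X * (\<kappa> * (1 - 2 * \<kappa>))" using \<open>0 \<le> X\<close> \<kappa> by simp
    then have "X \<le> X * (1 + 2 * \<kappa>) * (1 - \<kappa>)" by (simp add: algebra_simps)
    then show ?thesis using \<kappa> by (simp add: pos_divide_le_eq)
  qed
  also have "\<dots> \<le> X + 2 * \<kappa> * L"
    using mult_left_mono[OF \<open>X \<le> L\<close>, of "2 * \<kappa>"] \<kappa> by (simp add: algebra_simps)
  finally have "X / (1 - \<kappa>) \<le> qh_dist \<Omega> x w + \<eta> - dist u w / (bd w + dist u w)"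
    using X \<kappa>'(2) unfolding X_def[symmetric] L_def by linarith
  moreover have "qh_dist \<Omega> x u \<le> X / (1 - \<kappa>)"
    using qh_dist_le_steps[OF u(2) assms(1) \<kappa>(1)] \<kappa> by (simp add: X_def)
  ultimately show thesis
    using that[of u] steps_pow_domain[OF u(2) assms(1)] u by linarith
qed

end

section \<open>Support functionals of a uniformly smooth norm\<close>

lemma uniformly_smoothD:
  assumes "uniformly_smooth TYPE('a::real_normed_vector)" "0 < \<epsilon>"
  obtains \<delta> where "0 < \<delta>"
    "\<And>u v :: 'a. norm u = 1 \<Longrightarrow> norm v < \<delta> \<Longrightarrow> norm (u + v) + norm (u - v) \<le> 2 + 2 * \<epsilon> * norm v"
proof -
  have "\<forall>\<^sub>F \<tau> in at_right 0. dist (modulus_of_smoothness TYPE('a) \<tau> / \<tau>) 0 < \<epsilon>"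
    using assms unfolding uniformly_smooth_def by (rule tendstoD)
  then obtain \<delta> where \<delta>: "0 < \<delta>"
    "\<And>\<tau>. 0 < \<tau> \<Longrightarrow> \<tau> < \<delta> \<Longrightarrow> \<bar>modulus_of_smoothness TYPE('a) \<tau> / \<tau>\<bar> < \<epsilon>"
    unfolding eventually_at_right_field by auto
  have "norm (u + v) + norm (u - v) \<le> 2 + 2 * \<epsilon> * norm v"
    if "norm u = 1" "norm v < \<delta>" for u v :: 'a
  proof (cases "v = 0")
    case True
    then show ?thesis using that by simp
  next
    case False
    let ?S = "{(norm (u + w) + norm (u - w)) / 2 - 1 | u w :: 'a. norm u = 1 \<and> norm w = norm v}"
    \<comment> \<open>A real \<open>Sup\<close> is known to dominate its set only if this is bounded
      above; the triangle inequality provides the bound.\<close>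
    have "r \<le> norm v" if r_in: "r \<in> ?S" for r
    proof -
      obtain u' w :: 'a where r: "r = (norm (u' + w) + norm (u' - w)) / 2 - 1"
        and "norm u' = 1" "norm w = norm v"
        using r_in by auto
      then have "norm (u' + w) \<le> 1 + norm v" "norm (u' - w) \<le> 1 + norm v"
        using norm_triangle_ineq[of u' w] norm_triangle_ineq4[of u' w] by auto
      then show ?thesis unfolding r by (simp add: field_simps)
    qed
    then have "(norm (u + v) + norm (u - v)) / 2 - 1 \<le> modulus_of_smoothness TYPE('a) (norm v)"
      unfolding modulus_of_smoothness_def using that by (intro cSup_upper bdd_aboveI[of _ "norm v"]) auto
    moreover have "modulus_of_smoothness TYPE('a) (norm v) \<le> \<epsilon> * norm v"
      using \<delta>(2)[of "norm v"] that False by (simp add: field_simps abs_less_iff)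
    ultimately show ?thesis by (simp add: field_simps)
  qed
  then show thesis using that \<delta>(1) by blast
qed

text \<open>The functional is the one-sided directional derivative of the norm, which smoothness makes
  linear; this replaces an appeal to the Hahn--Banach theorem.\<close>

lemma smooth_support_functional:
  fixes v :: "'a::real_normed_vector"
  assumes smooth: "uniformly_smooth TYPE('a)" and v: "norm v = 1"
  obtains p :: "'a \<Rightarrow>\<^sub>L real" where "norm p \<le> 1" "blinfun_apply p v = 1"
    "\<And>h. blinfun_apply p h \<le> norm (v + h) - 1"
proof -
  \<comment> \<open>The quotients \<open>q t h\<close> decrease as \<open>t\<close> decreases to 0,
    so their infimum \<open>N h\<close> is the one-sided derivative of the norm at
    \<open>v\<close>.\<close>
  define q where "q t h = (norm (v + t *\<^sub>R h) - 1) / t" for t h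
  define N where "N h = (INF t\<in>{0<..}. q t h)" for h
  have q_mono: "q s h \<le> q t h" if "0 < s" "s \<le> t" for s t h
  proof -
    have eq: "v + s *\<^sub>R h = (1 - s / t) *\<^sub>R v + (s / t) *\<^sub>R (v + t *\<^sub>R h)"
      using that by (simp add: algebra_simps)
    have "norm (v + s *\<^sub>R h) \<le> norm ((1 - s / t) *\<^sub>R v) + norm ((s / t) *\<^sub>R (v + t *\<^sub>R h))"
      unfolding eq by (rule norm_triangle_ineq)
    also have "\<dots> = (1 - s / t) + (s / t) * norm (v + t *\<^sub>R h)"
      using that v by (simp add: abs_of_nonneg)
    also have "\<dots> = 1 + s * q t h"
      using that by (simp add: q_def field_simps)
    finally have "norm (v + s *\<^sub>R h) - 1 \<le> s * q t h" by simp
    then show ?thesis using that unfolding q_def[of s] by (simp add: pos_divide_le_eq mult.commute)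
  qed
  have q_ge: "- norm h \<le> q t h" if "0 < t" for t h
    using norm_diff_ineq[of v "t *\<^sub>R h"] that v by (simp add: q_def field_simps)
  have bdd: "bdd_below ((\<lambda>t. q t h) ` {0<..})" for h
    using q_ge by (intro bdd_belowI2[of _ "- norm h"]) auto
  have N_le: "N h \<le> q t h" if "0 < t" for t h
    unfolding N_def using that bdd by (intro cINF_lower) auto
  have N_greatest: "C \<le> N h" if "\<And>t. 0 < t \<Longrightarrow> C \<le> q t h" for C h
    unfolding N_def using that by (intro cINF_greatest) auto
  have N_approx: "\<exists>s>0. \<forall>t. 0 < t \<longrightarrow> t \<le> s \<longrightarrow> q t h < N h + e" if "0 < e" for e h
  proof -
    have "\<exists>s\<in>{0<..}. q s h < N h + e"
      using cINF_less_iff[OF _ bdd, of h "N h + e"] that by (simp add: N_def)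
    then show ?thesis using q_mono le_less_trans by (metis greaterThan_iff)
  qed
  have add_le: "N (h + k) \<le> N h + N k" for h k
  proof (rule field_le_epsilon)
    fix e :: real assume "0 < e"
    then obtain s s' where s: "0 < s" "\<And>t. 0 < t \<Longrightarrow> t \<le> s \<Longrightarrow> q t h < N h + e / 2"
      and s': "0 < s'" "\<And>t. 0 < t \<Longrightarrow> t \<le> s' \<Longrightarrow> q t k < N k + e / 2"
      using N_approx[of "e / 2" h] N_approx[of "e / 2" k] by auto
    define t where "t = min s s'"
    have t: "0 < t" "q t h < N h + e / 2" "q t k < N k + e / 2"
      using s s' by (auto simp: t_def)
    have eq: "v + (t / 2) *\<^sub>R (h + k) = (1 / 2) *\<^sub>R (v + t *\<^sub>R h) + (1 / 2) *\<^sub>R (v + t *\<^sub>R k)"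
      by (simp add: scaleR_add_right add_ac flip: scaleR_add_left)
    have "norm (v + (t / 2) *\<^sub>R (h + k)) \<le> norm (v + t *\<^sub>R h) / 2 + norm (v + t *\<^sub>R k) / 2"
      unfolding eq
      using norm_triangle_ineq[of "(1 / 2) *\<^sub>R (v + t *\<^sub>R h)" "(1 / 2) *\<^sub>R (v + t *\<^sub>R k)"] by simp
    then have "2 * norm (v + (t / 2) *\<^sub>R (h + k)) - 2 \<le> (norm (v + t *\<^sub>R h) - 1) + (norm (v + t *\<^sub>R k) - 1)"
      by simp
    then have "(2 * norm (v + (t / 2) *\<^sub>R (h + k)) - 2) / t \<le> q t h + q t k"
      unfolding q_def add_divide_distrib[symmetric] using t(1) by (intro divide_right_mono) auto
    moreover have "q (t / 2) (h + k) = (2 * norm (v + (t / 2) *\<^sub>R (h + k)) - 2) / t"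
      using t(1) by (simp add: q_def field_simps)
    ultimately show "N (h + k) \<le> N h + N k + e"
      using N_le[of "t / 2" "h + k"] t by simp
  qed
  \<comment> \<open>Smoothness enters here: together with subadditivity it makes \<open>N\<close>
    odd, hence additive.\<close>
  have opp_le: "N h + N (- h) \<le> 0" for h
  proof (rule field_le_epsilon)
    fix e :: real assume "0 < e"
    define \<epsilon> where "\<epsilon> = (e / 2) / (norm h + 1)"
    have "0 < \<epsilon>" using \<open>0 < e\<close> by (simp add: \<epsilon>_def add_nonneg_pos)
    obtain \<delta> where \<delta>: "0 < \<delta>" "\<And>u w :: 'a. norm u = 1 \<Longrightarrow> norm w < \<delta> \<Longrightarrow>
        norm (u + w) + norm (u - w) \<le> 2 + 2 * \<epsilon> * norm w"
      using uniformly_smoothD[OF smooth \<open>0 < \<epsilon>\<close>] by blast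
    define t where "t = \<delta> / (norm h + 1)"
    have t: "0 < t" using \<delta>(1) by (simp add: t_def add_nonneg_pos)
    have "norm h + 1 \<noteq> 0" using norm_ge_zero[of h] by linarith
    then have "t * (norm h + 1) = \<delta>" by (simp add: t_def)
    then have "norm (t *\<^sub>R h) < \<delta>" using t by (simp add: distrib_left)
    then have "norm (v + t *\<^sub>R h) + norm (v - t *\<^sub>R h) \<le> 2 + 2 * \<epsilon> * (t * norm h)"
      using \<delta>(2)[OF v, of "t *\<^sub>R h"] t by simp
    then have "(norm (v + t *\<^sub>R h) - 1) + (norm (v - t *\<^sub>R h) - 1) \<le> 2 * \<epsilon> * norm h * t"
      by (simp add: mult_ac)
    then have "q t h + q t (- h) \<le> 2 * \<epsilon> * norm h"
      unfolding q_def add_divide_distrib[symmetric] using t by (simp add: pos_divide_le_eq)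
    also have "\<dots> \<le> e"
    proof -
      have "\<epsilon> * (norm h + 1) = e / 2"
        by (rule iffD1[OF nonzero_eq_divide_eq[OF \<open>norm h + 1 \<noteq> 0\<close>] \<epsilon>_def])
      then show ?thesis using \<open>0 < \<epsilon>\<close> by (simp add: distrib_left)
    qed
    finally show "N h + N (- h) \<le> 0 + e"
      using N_le[OF t, of h] N_le[OF t, of "- h"] by simp
  qed
  have "N 0 = 0"
    unfolding N_def q_def using v by simp
  then have N_minus: "N (- h) = - N h" for h
    using opp_le[of h] add_le[of h "- h"] by simp
  have N_add: "N (h + k) = N h + N k" for h k
    using add_le[of h k] add_le[of "h + k" "- k"] N_minus[of k] by simp
  have scale_le: "N (c *\<^sub>R h) \<le> c * N h" if "0 < c" for c h
  proof -
    have "N (c *\<^sub>R h) / c \<le> q t h" if "0 < t" for t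
    proof -
      have "N (c *\<^sub>R h) \<le> q (t / c) (c *\<^sub>R h)" using that \<open>0 < c\<close> by (intro N_le) simp
      also have "\<dots> = c * q t h" using that \<open>0 < c\<close> by (simp add: q_def)
      finally show ?thesis using \<open>0 < c\<close> by (simp add: pos_divide_le_eq mult.commute)
    qed
    then have "N (c *\<^sub>R h) / c \<le> N h" by (rule N_greatest)
    then show ?thesis using that by (simp add: pos_divide_le_eq mult.commute)
  qed
  have scale_pos: "N (c *\<^sub>R h) = c * N h" if "0 < c" for c h
    using scale_le[OF that, of h] scale_le[of "1 / c" "c *\<^sub>R h"] that by (simp add: field_simps)
  have N_scale: "N (c *\<^sub>R h) = c * N h" for c h
  proof -
    consider "0 < c" | "c = 0" | "0 < - c" by linarith
    then show ?thesis
    proof cases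
      case 3
      then show ?thesis using scale_pos[OF 3, of h] N_minus[of "c *\<^sub>R h"] by simp
    qed (use scale_pos \<open>N 0 = 0\<close> in auto)
  qed
  have N_sub: "N h \<le> norm (v + h) - 1" for h
    using N_le[of 1 h] by (simp add: q_def)
  have N_norm: "\<bar>N h\<bar> \<le> norm h" for h
    using N_sub[of h] N_sub[of "- h"] N_minus[of h] norm_triangle_ineq[of v h]
      norm_triangle_ineq4[of v h] v by (simp add: abs_le_iff)
  have lin: "bounded_linear N"
    by (rule bounded_linear_intro[of _ 1]) (use N_add N_scale N_norm in auto)
  then have app: "blinfun_apply (Blinfun N) = N" by (rule bounded_linear_Blinfun_apply)
  have "norm (Blinfun N) \<le> 1"
    by (rule norm_blinfun_bound) (use N_norm in \<open>auto simp: app\<close>)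
  moreover have "N v = 1"
    using N_sub[of "- v"] N_minus[of v] N_norm[of v] v by simp
  ultimately show thesis using that[of "Blinfun N"] N_sub by (simp add: app)
qed

section \<open>Comparison of two norming functionals\<close>

lemma norm_blinfun_apply_le:
  fixes p :: "'a::real_normed_vector \<Rightarrow>\<^sub>L real"
  assumes "norm p \<le> C"
  shows "\<bar>blinfun_apply p h\<bar> \<le> C * norm h"
  using norm_blinfun[of p h] mult_right_mono[OF assms norm_ge_zero[of h]] by simp

text \<open>Testing \<open>imp\<close> on vectors slightly on the negative side of \<open>p\<close>
  shows that on unit vectors \<open>q\<close> exceeds the multiple \<open>blinfun_apply q v\<close>
  of \<open>p\<close> by at most \<open>7 * a\<close>. The norming vector \<open>u\<close> of
  \<open>q\<close> then forces this multiple to be close to 1.\<close>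

lemma close_functionals:
  fixes p q :: "'a::real_normed_vector \<Rightarrow>\<^sub>L real"
  assumes p: "norm p \<le> 1" "norm v = 1" "blinfun_apply p v = 1"
    and q: "norm q \<le> 1" "norm u = 1" "blinfun_apply q u = 1"
    and a: "0 \<le> a" "a \<le> 1 / 16"
    and imp: "\<And>g. norm g \<le> 1 \<Longrightarrow> blinfun_apply p g \<le> - a \<Longrightarrow> blinfun_apply q g < a"
  shows "norm (q - p) \<le> 14 * a"
proof -
  have p_le: "\<bar>blinfun_apply p h\<bar> \<le> norm h" and q_le: "\<bar>blinfun_apply q h\<bar> \<le> norm h" for h
    using norm_blinfun_apply_le[OF p(1), of h] norm_blinfun_apply_le[OF q(1), of h] by auto
  have upper: "blinfun_apply q h \<le> blinfun_apply p h * blinfun_apply q v + 7 * a" if "norm h = 1" for h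
  proof -
    \<comment> \<open>Subtracting \<open>b\<close> times \<open>v\<close> moves \<open>h\<close> to
      where \<open>p\<close> equals \<open>- 4 * a\<close>. The factor 1/3 brings the norm down to
      at most 1, while the value \<open>- 4 * a / 3\<close> of \<open>p\<close> is still at most
      \<open>- a\<close>.\<close>
    define b where "b = blinfun_apply p h + 4 * a"
    define g where "g = (1 / 3) *\<^sub>R (h - b *\<^sub>R v)"
    have "\<bar>b\<bar> \<le> 1 + 4 * a" using p_le[of h] that a by (simp add: b_def)
    then have "norm (h - b *\<^sub>R v) \<le> 3"
      using norm_triangle_ineq4[of h "b *\<^sub>R v"] that p(2) a by simp
    then have "norm g \<le> 1" by (simp add: g_def)
    moreover have "blinfun_apply p g = - (4 * a / 3)"
      by (simp add: g_def blinfun.diff_right blinfun.scaleR_right p b_def)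
    ultimately have "blinfun_apply q g < a" using imp a by simp
    then have "blinfun_apply q h - b * blinfun_apply q v < 3 * a"
      by (simp add: g_def blinfun.diff_right blinfun.scaleR_right)
    moreover have "a * blinfun_apply q v \<le> a * 1"
      using q_le[of v] p(2) a by (intro mult_left_mono) auto
    ultimately show ?thesis by (simp add: b_def algebra_simps)
  qed
  \<comment> \<open>Excludes \<open>q\<close> near \<open>- p\<close>: if
    \<open>blinfun_apply q v\<close> were negative, its absolute value would be below
    \<open>a\<close>, and \<open>1 \<le> a + 7 * a\<close> contradicts
    \<open>a \<le> 1 / 16\<close>.\<close>
  have "- a < blinfun_apply q v"
    using imp[of "- v"] p a by (simp add: blinfun.minus_right)
  have "1 \<le> blinfun_apply p u * blinfun_apply q v + 7 * a"
    using upper[OF q(2)] q(3) by simp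
  have qv: "1 - 7 * a \<le> blinfun_apply q v"
  proof (cases "0 \<le> blinfun_apply q v")
    case True
    have "blinfun_apply p u * blinfun_apply q v \<le> 1 * blinfun_apply q v"
      using p_le[of u] q(2) True by (intro mult_right_mono) auto
    then show ?thesis using \<open>1 \<le> blinfun_apply p u * blinfun_apply q v + 7 * a\<close> by simp
  next
    case False
    have "blinfun_apply p u * blinfun_apply q v \<le> \<bar>blinfun_apply p u\<bar> * \<bar>blinfun_apply q v\<bar>"
      by (simp add: abs_mult[symmetric])
    also have "\<dots> \<le> 1 * a"
      using p_le[of u] q(2) False \<open>- a < blinfun_apply q v\<close> by (intro mult_mono) auto
    finally show ?thesis using \<open>1 \<le> blinfun_apply p u * blinfun_apply q v + 7 * a\<close> a by simp
  qed
  have le: "blinfun_apply q h - blinfun_apply p h \<le> 14 * a" if "norm h = 1" for h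
  proof -
    have "blinfun_apply p h * (blinfun_apply q v - 1) \<le> \<bar>blinfun_apply p h\<bar> * \<bar>blinfun_apply q v - 1\<bar>"
      by (simp add: abs_mult[symmetric])
    also have "\<dots> \<le> 1 * (7 * a)"
      using p_le[of h] q_le[of v] that p(2) qv by (intro mult_mono) auto
    finally show ?thesis using upper[OF that] by (simp add: algebra_simps)
  qed
  show ?thesis
  proof (rule norm_blinfun_bound)
    fix h :: 'a
    show "norm (blinfun_apply (q - p) h) \<le> 14 * a * norm h"
    proof (cases "h = 0")
      case False
      define h' where "h' = (1 / norm h) *\<^sub>R h"
      have h': "norm h' = 1" "h = norm h *\<^sub>R h'" using False by (auto simp: h'_def)
      have "\<bar>blinfun_apply q h' - blinfun_apply p h'\<bar> \<le> 14 * a"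
        using le[of h'] le[of "- h'"] h'(1) by (simp add: blinfun.minus_right abs_le_iff)
      then have "norm h * \<bar>blinfun_apply q h' - blinfun_apply p h'\<bar> \<le> norm h * (14 * a)"
        by (intro mult_left_mono) auto
      moreover have "blinfun_apply (q - p) h = norm h * (blinfun_apply q h' - blinfun_apply p h')"
        by (subst h'(2)) (simp only: blinfun.scaleR_right blinfun.diff_left real_scaleR_def)
      ultimately show ?thesis by (simp add: abs_mult mult.commute)
    qed simp
  qed (use a in simp)
qed

section \<open>Differentiability of quasiconvex functions with approximate superderivatives\<close>

text \<open>The error is relative to the radius, so \<open>e\<close> can be compared across scales.
  The unit vector at which \<open>p\<close> equals 1 feeds \<open>close_functionals\<close> and
  keeps limits of such \<open>p\<close> away from 0.\<close>

definition superderivative ::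
  "('a::real_normed_vector \<Rightarrow> real) \<Rightarrow> real \<Rightarrow> 'a \<Rightarrow> real \<Rightarrow> real \<Rightarrow> ('a \<Rightarrow>\<^sub>L real) \<Rightarrow> bool" where
  "superderivative f c w \<sigma> e p \<longleftrightarrow> norm p \<le> 1 \<and> (\<exists>v. norm v = 1 \<and> blinfun_apply p v = 1) \<and>
     (\<forall>g. norm g \<le> \<sigma> \<longrightarrow> f (w + g) \<le> f w + c * blinfun_apply p g + e * \<sigma>)"

lemma superderivative_mono:
  "superderivative f c w \<sigma> e p \<Longrightarrow> e \<le> e' \<Longrightarrow> 0 \<le> \<sigma> \<Longrightarrow> superderivative f c w \<sigma> e' p"
  unfolding superderivative_def using mult_right_mono[of e e' \<sigma>] by fastforce

text \<open>What the argument uses of \<open>f = qh_dist \<Omega> x\<close> near \<open>z\<close>,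
  with \<open>c = 1 / bd z\<close> and \<open>R = bd z / 2\<close>. In the last assumption one
  threshold serves all base points \<open>w\<close> within \<delta> of \<open>z\<close>.\<close>

locale quasiconvex_superdifferentiable =
  fixes f :: "'a::banach \<Rightarrow> real" and z :: 'a and c R :: real
  assumes c: "0 < c" and R: "0 < R"
    and quasiconvex: "\<And>u v t C. dist u z < R \<Longrightarrow> dist v z < R \<Longrightarrow> 0 \<le> t \<Longrightarrow> t \<le> 1 \<Longrightarrow>
      f u \<le> C \<Longrightarrow> f v \<le> C \<Longrightarrow> f ((1 - t) *\<^sub>R u + t *\<^sub>R v) \<le> C"
    and lipschitz: "\<And>u v. dist u z < R \<Longrightarrow> dist v z < R \<Longrightarrow> f v \<le> f u + 2 * c * dist u v"
    and superderivatives: "\<And>e. 0 < e \<Longrightarrow> \<exists>\<delta>\<^sub>0>0. \<forall>\<delta>>0. \<delta> < \<delta>\<^sub>0 \<longrightarrow>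
      (\<forall>w. dist w z \<le> \<delta> \<longrightarrow> (\<exists>p. superderivative f c w \<delta> e p))"
begin

definition K :: real where "K = 14 * (1 / c + 5)"

lemma K_pos: "0 < K"
  using c by (simp add: K_def add_pos_pos)

text \<open>If the functionals differed, some direction \<open>g\<close> would give \<open>f\<close> values well below \<open>f z\<close> both at
  \<open>z + \<delta> g\<close> and at \<open>w - \<sigma> g\<close>, hence also at a point between \<open>z\<close> and \<open>w\<close>.\<close>

lemma superderivatives_close:
  assumes p: "superderivative f c z \<delta> e p" and q: "superderivative f c w \<sigma> e q"
    and \<sigma>: "0 < \<sigma>" "\<sigma> \<le> \<delta>" "2 * \<delta> < R" and e: "0 < e" "K * e \<le> 7 / 8"
    and w: "dist w z \<le> e * \<sigma>"
  shows "norm (q - p) \<le> K * e"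
proof -
  \<comment> \<open>Chosen so that \<open>c * a = e + 5 * c * e\<close>: the \<open>e\<close>
    cancels the error of the superderivatives, and 5 exceeds the 2 + 2 lost through
    \<open>lipschitz\<close> in passing between \<open>z\<close> and \<open>w\<close>. The factor 14
    in \<open>K\<close> is that of \<open>close_functionals\<close>.\<close>
  define a where "a = (1 / c + 5) * e"
  have Ke: "K * e = 14 * a" by (simp add: K_def a_def)
  have a: "0 \<le> a" "a \<le> 1 / 16" using e c by (auto simp: Ke) (simp add: a_def)
  have ca: "c * a = e + 5 * c * e" using c by (simp add: a_def field_simps)
  have "5 * e \<le> a" using c e by (simp add: a_def distrib_right)
  then have "e \<le> 1" using a e by linarith
  have w': "dist w z \<le> \<sigma>"
    using w mult_right_mono[OF \<open>e \<le> 1\<close>, of \<sigma>] \<sigma> by linarith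
  have R': "dist z z < R" "dist w z < R" using w' \<sigma> R by auto
  have "2 * c * dist z w \<le> 2 * c * (e * \<sigma>)"
    using w c by (intro mult_left_mono) (auto simp: dist_commute)
  then have fw: "f w \<le> f z + 2 * c * (e * \<sigma>)"
    using lipschitz[OF R'(1,2)] by linarith
  have imp: "blinfun_apply q g < a" if g: "norm g \<le> 1" "blinfun_apply p g \<le> - a" for g
  proof (rule ccontr)
    assume "\<not> blinfun_apply q g < a"
    then have qg: "a \<le> blinfun_apply q g" by simp
    have small: "norm (\<delta> *\<^sub>R g) \<le> \<delta>" "norm (\<sigma> *\<^sub>R g) \<le> \<sigma>"
      using g(1) \<sigma> by (auto simp: mult_left_le)
    define C where "C = f z - 3 * c * (e * \<sigma>)"
    have "f (z + \<delta> *\<^sub>R g) \<le> f z + c * blinfun_apply p (\<delta> *\<^sub>R g) + e * \<delta>"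
      using p small(1) unfolding superderivative_def by blast
    also have "blinfun_apply p (\<delta> *\<^sub>R g) = \<delta> * blinfun_apply p g"
      by (simp add: blinfun.scaleR_right)
    also have "c * (\<delta> * blinfun_apply p g) \<le> c * (\<delta> * (- a))"
      using c \<sigma> g(2) by (intro mult_left_mono) auto
    also have "c * (\<delta> * (- a)) = - (\<delta> * (c * a))" by simp
    also have "f z + - (\<delta> * (c * a)) + e * \<delta> = f z - 5 * c * (e * \<delta>)"
      unfolding ca by (simp add: algebra_simps)
    also have "\<dots> \<le> C"
    proof -
      have "c * (e * \<sigma>) \<le> c * (e * \<delta>)" "0 \<le> c * (e * \<sigma>)"
        using c e \<sigma> by (auto intro!: mult_left_mono)
      then show ?thesis unfolding C_def by linarith
    qed
    finally have 1: "f (z + \<delta> *\<^sub>R g) \<le> C" by simp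
    have "norm (- (\<sigma> *\<^sub>R g)) \<le> \<sigma>" using small(2) by simp
    then have "f (w + - (\<sigma> *\<^sub>R g)) \<le> f w + c * blinfun_apply q (- (\<sigma> *\<^sub>R g)) + e * \<sigma>"
      using q unfolding superderivative_def by blast
    also have "w + - (\<sigma> *\<^sub>R g) = w - \<sigma> *\<^sub>R g" by simp
    also have "blinfun_apply q (- (\<sigma> *\<^sub>R g)) = (- \<sigma>) * blinfun_apply q g"
      by (simp add: blinfun.minus_right blinfun.scaleR_right)
    also have "c * ((- \<sigma>) * blinfun_apply q g) \<le> - (\<sigma> * (c * a))"
      using mult_left_mono[OF qg, of "c * \<sigma>"] c \<sigma> by (simp add: algebra_simps)
    also have "f w + - (\<sigma> * (c * a)) + e * \<sigma> = f w - 5 * c * (e * \<sigma>)"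
      unfolding ca by (simp add: algebra_simps)
    also have "\<dots> \<le> C" using fw unfolding C_def by (simp add: algebra_simps)
    finally have 2: "f (w - \<sigma> *\<^sub>R g) \<le> C" by simp
    \<comment> \<open>This weight cancels the multiples of \<open>g\<close>, leaving a point on the
      segment from \<open>z\<close> to \<open>w\<close>, where by \<open>lipschitz\<close> the value
      of \<open>f\<close> cannot be as small as \<open>C\<close>.\<close>
    define t where "t = \<delta> / (\<sigma> + \<delta>)"
    have t: "0 \<le> t" "t \<le> 1" using \<sigma> by (auto simp: t_def)
    have eq: "(1 - t) *\<^sub>R (z + \<delta> *\<^sub>R g) + t *\<^sub>R (w - \<sigma> *\<^sub>R g) = z + t *\<^sub>R (w - z)"
    proof -
      have "(1 - t) * \<delta> - t * \<sigma> = 0" using \<sigma> by (simp add: t_def field_simps)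
      moreover have "(1 - t) *\<^sub>R (z + \<delta> *\<^sub>R g) + t *\<^sub>R (w - \<sigma> *\<^sub>R g) =
          z + t *\<^sub>R (w - z) + ((1 - t) * \<delta> - t * \<sigma>) *\<^sub>R g"
        by (simp add: algebra_simps)
      ultimately show ?thesis by simp
    qed
    have "dist (z + \<delta> *\<^sub>R g) z = norm (\<delta> *\<^sub>R g)" by (simp add: dist_norm)
    then have "dist (z + \<delta> *\<^sub>R g) z < R" using small(1) \<sigma> by linarith
    moreover have "dist (w - \<sigma> *\<^sub>R g) z < R"
    proof -
      have "dist (w - \<sigma> *\<^sub>R g) z \<le> dist w z + norm (\<sigma> *\<^sub>R g)"
        using norm_triangle_ineq4[of "w - z" "\<sigma> *\<^sub>R g"] by (simp add: dist_norm algebra_simps)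
      then show ?thesis using w' small(2) \<sigma> by linarith
    qed
    ultimately have below: "f (z + t *\<^sub>R (w - z)) \<le> C"
      using quasiconvex[OF _ _ t 1 2] unfolding eq by blast
    have "dist (z + t *\<^sub>R (w - z)) z = t * dist w z" using t by (simp add: dist_norm)
    also have "\<dots> \<le> dist w z" using t by (simp add: mult_left_le_one_le)
    finally have d: "dist (z + t *\<^sub>R (w - z)) z \<le> dist w z" .
    have "f z \<le> f (z + t *\<^sub>R (w - z)) + 2 * c * dist (z + t *\<^sub>R (w - z)) z"
      using d R' by (intro lipschitz) auto
    also have "\<dots> \<le> C + 2 * c * (e * \<sigma>)"
      using below d w c by (intro add_mono mult_left_mono) auto
    finally have "c * (e * \<sigma>) \<le> 0" unfolding C_def by (simp add: algebra_simps)
    then show False using c e \<sigma> by (simp add: mult_le_0_iff)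
  qed
  obtain v u where "norm v = 1" "blinfun_apply p v = 1" "norm u = 1" "blinfun_apply q u = 1"
    using p q by (auto simp: superderivative_def)
  then show ?thesis
    unfolding Ke using p q a imp
    by (intro close_functionals[of p v q u a]) (auto simp: superderivative_def)
qed

text \<open>Functionals at \<open>z\<close> with errors \<open>e n\<close> tending to 0 form a
  Cauchy sequence by \<open>superderivatives_close\<close> and converge in the dual space. A
  functional at a small scale and a nearby base point is compared with one of them.\<close>

lemma limit_functional:
  obtains P :: "'a \<Rightarrow>\<^sub>L real" where "P \<noteq> 0"
    "\<And>e. 0 < e \<Longrightarrow> K * e \<le> 7 / 8 \<Longrightarrow> \<exists>\<sigma>\<^sub>0>0. \<forall>\<sigma> w q. 0 < \<sigma> \<longrightarrow> \<sigma> \<le> \<sigma>\<^sub>0 \<longrightarrow> dist w z \<le> e * \<sigma> \<longrightarrow>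
      superderivative f c w \<sigma> e q \<longrightarrow> norm (q - P) \<le> 2 * K * e"
proof -
  define e where "e n = 1 / (2 * K * (real n + 1))" for n :: nat
  have e: "0 < e n" "K * e n \<le> 7 / 8" for n
  proof -
    show "0 < e n" using K_pos by (simp add: e_def)
    have "K * e n = 1 / (2 * (real n + 1))" using K_pos by (simp add: e_def)
    also have "\<dots> \<le> 7 / 8" by (simp add: field_simps)
    finally show "K * e n \<le> 7 / 8" .
  qed
  have e_anti: "e n \<le> e m" if "m \<le> n" for m n
    using that K_pos by (auto simp: e_def intro!: divide_left_mono mult_left_mono)
  have "(\<lambda>n. 1 / (2 * K) * (1 / real (Suc n))) \<longlonglongrightarrow> 1 / (2 * K) * 0"
    using LIMSEQ_inverse_real_of_nat by (intro tendsto_mult_left) (simp add: inverse_eq_divide)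
  then have e_lim: "e \<longlonglongrightarrow> 0"
    by (simp add: e_def[abs_def] add.commute)
  have "\<exists>\<delta> p. 0 < \<delta> \<and> 2 * \<delta> < R \<and> superderivative f c z \<delta> (e n) p" for n
  proof -
    obtain \<delta>\<^sub>0 where "\<delta>\<^sub>0 > 0" and \<delta>\<^sub>0: "\<And>\<delta> w. 0 < \<delta> \<Longrightarrow> \<delta> < \<delta>\<^sub>0 \<Longrightarrow> dist w z \<le> \<delta> \<Longrightarrow>
        \<exists>p. superderivative f c w \<delta> (e n) p"
      using superderivatives[OF e(1)[of n]] by blast
    define \<delta> where "\<delta> = min \<delta>\<^sub>0 R / 3"
    have "0 < \<delta>" "\<delta> < \<delta>\<^sub>0" "2 * \<delta> < R" using \<open>\<delta>\<^sub>0 > 0\<close> R by (auto simp: \<delta>_def)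
    then show ?thesis using \<delta>\<^sub>0[of \<delta> z] by auto
  qed
  then obtain \<delta> p where \<delta>: "\<And>n. 0 < \<delta> n" "\<And>n. 2 * \<delta> n < R"
    and p: "\<And>n. superderivative f c z (\<delta> n) (e n) (p n)"
    by metis
  have close: "norm (p n - p m) \<le> K * e k" if "k \<le> n" "k \<le> m" for n m k
  proof -
    have sup: "superderivative f c z (\<delta> i) (e k) (p i)" if "k \<le> i" for i
      using superderivative_mono[OF p e_anti[OF that]] \<delta>(1)[of i] by simp
    \<comment> \<open>\<open>superderivatives_close\<close> wants the smaller scale second, so the
      scales are ordered; both functionals are viewed with the common error
      \<open>e k\<close>.\<close>
    have *: "norm (p i - p j) \<le> K * e k" if "k \<le> i" "k \<le> j" "\<delta> i \<le> \<delta> j" for i j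
      using superderivatives_close[OF sup[OF that(2)] sup[OF that(1)] \<delta>(1) that(3) \<delta>(2) e]
        e(1)[of k] \<delta>(1)[of i] by (simp add: less_imp_le)
    show ?thesis
      using *[of n m] *[of m n] that norm_minus_commute[of "p n" "p m"] by (cases "\<delta> n \<le> \<delta> m") auto
  qed
  have Ke_lim: "(\<lambda>n. K * e n) \<longlonglongrightarrow> 0"
    using tendsto_mult_left[OF e_lim, of K] by simp
  have "Cauchy p"
  proof (rule CauchyI)
    fix \<epsilon> :: real assume "0 < \<epsilon>"
    then obtain k where "K * e k < \<epsilon>"
      using order_tendstoD(2)[OF Ke_lim, of \<epsilon>] by (auto simp: eventually_sequentially)
    then show "\<exists>M. \<forall>m\<ge>M. \<forall>n\<ge>M. norm (p m - p n) < \<epsilon>"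
      using close le_less_trans by blast
  qed
  then obtain P where P: "p \<longlonglongrightarrow> P"
    using Cauchy_convergent_iff convergent_def by blast
  have pP: "norm (p k - P) \<le> K * e k" for k
  proof (rule tendsto_upperbound)
    show "(\<lambda>n. norm (p k - p n)) \<longlonglongrightarrow> norm (p k - P)"
      by (intro tendsto_intros P)
    show "\<forall>\<^sub>F n in sequentially. norm (p k - p n) \<le> K * e k"
      using close[of k k] by (auto simp: eventually_sequentially)
  qed simp
  show thesis
  proof (rule that)
    \<comment> \<open>\<open>p 0\<close> takes the value 1 at a unit vector, and \<open>P\<close> is
      within \<open>7 / 8\<close> of it.\<close>
    show "P \<noteq> 0"
    proof
      assume "P = 0"
      obtain v where "norm v = 1" "blinfun_apply (p 0) v = 1"
        using p[of 0] by (auto simp: superderivative_def)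
      then show False
        using norm_blinfun[of "p 0" v] pP[of 0] e(2)[of 0] \<open>P = 0\<close> by simp
    qed
    fix \<epsilon> :: real assume \<epsilon>: "0 < \<epsilon>" "K * \<epsilon> \<le> 7 / 8"
    obtain k where k: "e k < \<epsilon>"
      using order_tendstoD(2)[OF e_lim, of \<epsilon>] \<epsilon>(1) by (auto simp: eventually_sequentially)
    have Kk: "K * e k \<le> K * \<epsilon>" using k K_pos by simp
    have "norm (q - P) \<le> 2 * K * \<epsilon>"
      if "0 < \<sigma>" "\<sigma> \<le> \<delta> k" "dist w z \<le> \<epsilon> * \<sigma>" "superderivative f c w \<sigma> \<epsilon> q" for \<sigma> w q
    proof -
      have "superderivative f c z (\<delta> k) \<epsilon> (p k)"
        using superderivative_mono[OF p[of k]] k \<delta>(1)[of k] by simp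
      then have "norm (q - p k) \<le> K * \<epsilon>"
        using superderivatives_close[OF _ that(4,1,2) \<delta>(2) \<epsilon> that(3)] by blast
      then show ?thesis
        using norm_triangle_ineq[of "q - p k" "p k - P"] pP[of k] Kk by simp
    qed
    then show "\<exists>\<sigma>\<^sub>0>0. \<forall>\<sigma> w q. 0 < \<sigma> \<longrightarrow> \<sigma> \<le> \<sigma>\<^sub>0 \<longrightarrow> dist w z \<le> \<epsilon> * \<sigma> \<longrightarrow>
      superderivative f c w \<sigma> \<epsilon> q \<longrightarrow> norm (q - P) \<le> 2 * K * \<epsilon>"
      using \<delta>(1)[of k] by blast
  qed
qed

lemma has_nonzero_derivative:
  obtains D where "(f has_derivative D) (at z)" "\<exists>h. D h \<noteq> 0"
proof -
  obtain P :: "'a \<Rightarrow>\<^sub>L real" where "P \<noteq> 0" and P: "\<And>e. 0 < e \<Longrightarrow> K * e \<le> 7 / 8 \<Longrightarrow>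
      \<exists>\<sigma>\<^sub>0>0. \<forall>\<sigma> w q. 0 < \<sigma> \<longrightarrow> \<sigma> \<le> \<sigma>\<^sub>0 \<longrightarrow> dist w z \<le> e * \<sigma> \<longrightarrow>
      superderivative f c w \<sigma> e q \<longrightarrow> norm (q - P) \<le> 2 * K * e"
    using limit_functional by blast
  have "(f has_derivative (\<lambda>h. c * blinfun_apply P h)) (at z)"
    unfolding has_derivative_at_alt
  proof (intro conjI allI impI)
    show "bounded_linear (\<lambda>h. c * blinfun_apply P h)"
      by (intro bounded_linear_const_mult blinfun.bounded_linear_right)
    fix \<epsilon> :: real assume "0 < \<epsilon>"
    define e where "e = min (min 1 (7 / (8 * K))) (\<epsilon> / (2 * c * K + 1))"
    have "0 < 2 * c * K + 1" using c K_pos by (simp add: add_pos_pos)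
    then have e: "0 < e" "e \<le> 1" "e \<le> 7 / (8 * K)" "e \<le> \<epsilon> / (2 * c * K + 1)"
      using \<open>0 < \<epsilon>\<close> K_pos by (auto simp: e_def)
    have Ke: "K * e \<le> 7 / 8" using e(3) K_pos by (simp add: field_simps)
    have e\<epsilon>: "2 * c * K * e + e \<le> \<epsilon>"
      using e(4) \<open>0 < 2 * c * K + 1\<close> by (simp add: pos_le_divide_eq algebra_simps)
    have ee: "0 < e * e" "e * e \<le> e" using e by (auto simp: mult_left_le)
    obtain \<sigma>\<^sub>0 where "\<sigma>\<^sub>0 > 0" and \<sigma>\<^sub>0: "\<And>\<sigma> w q. 0 < \<sigma> \<Longrightarrow> \<sigma> \<le> \<sigma>\<^sub>0 \<Longrightarrow> dist w z \<le> e * \<sigma> \<Longrightarrow>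
        superderivative f c w \<sigma> e q \<Longrightarrow> norm (q - P) \<le> 2 * K * e"
      using P[OF e(1) Ke] by blast
    obtain \<delta>\<^sub>0 where "\<delta>\<^sub>0 > 0" and \<delta>\<^sub>0: "\<And>\<delta> w. 0 < \<delta> \<Longrightarrow> \<delta> < \<delta>\<^sub>0 \<Longrightarrow> dist w z \<le> \<delta> \<Longrightarrow>
        \<exists>p. superderivative f c w \<delta> (e * e) p"
      using superderivatives[OF ee(1)] by blast
    define d where "d = e * min \<sigma>\<^sub>0 \<delta>\<^sub>0"
    have "0 < d" using e \<open>\<sigma>\<^sub>0 > 0\<close> \<open>\<delta>\<^sub>0 > 0\<close> by (simp add: d_def)
    moreover have "norm (f y - f z - c * blinfun_apply P (y - z)) \<le> \<epsilon> * norm (y - z)"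
      if y: "norm (y - z) < d" for y
    proof (cases "y = z")
      case False
      define h where "h = y - z"
      \<comment> \<open>The scale exceeds \<open>norm h\<close> by the factor \<open>1 / e\<close>,
        so base points within \<open>norm h\<close> of \<open>z\<close> satisfy the nearness
        condition of \<open>limit_functional\<close>. Superderivatives with error
        \<open>e * e\<close> keep the absolute error at
        \<open>e * e * \<sigma> = e * norm h\<close>.\<close>
      define \<sigma> where "\<sigma> = norm h / e"
      have \<sigma>: "0 < \<sigma>" "norm h = e * \<sigma>" using False e by (auto simp: \<sigma>_def h_def)
      have "\<sigma> < min \<sigma>\<^sub>0 \<delta>\<^sub>0"
        using y e unfolding \<sigma>_def d_def h_def by (simp only: pos_divide_less_eq mult.commute)
      then have \<sigma>': "\<sigma> \<le> \<sigma>\<^sub>0" "\<sigma> < \<delta>\<^sub>0" by auto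
      have h\<sigma>: "norm h \<le> \<sigma>" using mult_right_mono[OF e(2), of \<sigma>] \<sigma> by simp
      have near: "\<exists>q. superderivative f c w \<sigma> (e * e) q \<and> \<bar>blinfun_apply q h - blinfun_apply P h\<bar> \<le> 2 * K * e * norm h"
        if w: "dist w z \<le> norm h" for w
      proof -
        obtain q where q: "superderivative f c w \<sigma> (e * e) q"
          using \<delta>\<^sub>0[of \<sigma> w] \<sigma> \<sigma>' h\<sigma> w by auto
        then have "superderivative f c w \<sigma> e q"
          using superderivative_mono ee \<sigma> less_imp_le by blast
        then have "norm (q - P) \<le> 2 * K * e" using \<sigma>\<^sub>0 \<sigma> \<sigma>' w by auto
        then show ?thesis
          using q norm_blinfun_apply_le[of "q - P" "2 * K * e" h] by (auto simp: blinfun.diff_left)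
      qed
      obtain p where p: "superderivative f c z \<sigma> (e * e) p"
        "\<bar>blinfun_apply p h - blinfun_apply P h\<bar> \<le> 2 * K * e * norm h"
        using near[of z] by auto
      obtain q where q: "superderivative f c y \<sigma> (e * e) q"
        "\<bar>blinfun_apply q h - blinfun_apply P h\<bar> \<le> 2 * K * e * norm h"
        using near[of y] by (auto simp: h_def dist_norm)
      have err: "e * e * \<sigma> = e * norm h" using \<sigma> by simp
      have yz: "z + h = y" "y + (- h) = z" by (simp_all add: h_def)
      have "f (z + h) \<le> f z + c * blinfun_apply p h + e * norm h"
        using p(1) h\<sigma> unfolding superderivative_def err by blast
      \<comment> \<open>Going back from \<open>y\<close> to \<open>z\<close> turns an upper bound on
        \<open>f z\<close> into a lower bound on \<open>f y\<close>.\<close>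
      moreover have "f (y + (- h)) \<le> f y + c * blinfun_apply q (- h) + e * norm h"
        using q(1) h\<sigma> unfolding superderivative_def err by (metis norm_minus_cancel)
      moreover have "c * blinfun_apply p h \<le> c * (blinfun_apply P h + 2 * K * e * norm h)"
        using p(2) c by (intro mult_left_mono) auto
      moreover have "c * (blinfun_apply P h - 2 * K * e * norm h) \<le> c * blinfun_apply q h"
        using q(2) c by (intro mult_left_mono) auto
      moreover have "(2 * c * K * e + e) * norm h \<le> \<epsilon> * norm h"
        using e\<epsilon> by (intro mult_right_mono) auto
      ultimately show ?thesis
        unfolding yz blinfun.minus_right h_def[symmetric] by (simp add: abs_le_iff algebra_simps)
    qed simp
    ultimately show "\<exists>d>0. \<forall>y. norm (y - z) < d \<longrightarrow>
        norm (f y - f z - c * blinfun_apply P (y - z)) \<le> \<epsilon> * norm (y - z)"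
      by blast
  qed
  moreover have "\<exists>h. c * blinfun_apply P h \<noteq> 0"
    using \<open>P \<noteq> 0\<close> c by (metis blinfun_eqI mult_eq_0_iff order_less_irrefl zero_blinfun.rep_eq)
  ultimately show thesis using that by blast
qed

end

section \<open>Differentiability of the quasihyperbolic distance\<close>

text \<open>Replacing \<open>D - B\<close> and \<open>D + B\<close> by \<open>D\<close> changes
  quotients of terms of size at most \<open>B\<close> by multiples of
  \<open>B\<^sup>2 / D\<^sup>2\<close> only: 4 from the two \<open>T\<close> terms, 2 from
  \<open>y\<close>. In the application \<open>T\<close> is the distance from \<open>u\<close> to
  \<open>w\<close>, \<open>y\<close> the value of the functional and \<open>s\<close> the smoothness
  error.\<close>

lemma superderivative_error_bound:
  fixes D B T y s :: real
  assumes "0 < D" "0 \<le> B" "B \<le> D / 2" "0 \<le> T" "T \<le> B" "\<bar>y\<bar> \<le> B" "0 \<le> s"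
  shows "(T + y + s) / (D - B) - T / (D + B) \<le> y / D + 6 * B\<^sup>2 / D\<^sup>2 + 2 * s / D"
proof -
  have pos: "0 < D - B" "0 < D + B" using assms by auto
  have half: "D / 2 \<le> D - B" using assms by simp
  have "T / (D - B) - T / (D + B) = T * (2 * B) / ((D - B) * (D + B))"
    using pos by (simp add: field_simps)
  also have "\<dots> \<le> B * (2 * B) / (D / 2 * D)"
    using assms pos half by (intro frac_le mult_mono mult_right_mono) auto
  also have "\<dots> = 4 * B\<^sup>2 / D\<^sup>2" using assms by (simp add: power2_eq_square)
  finally have 1: "T / (D - B) - T / (D + B) \<le> 4 * B\<^sup>2 / D\<^sup>2" .
  have "y / (D - B) - y / D = y * B / ((D - B) * D)"
    using pos assms by (simp add: field_simps)
  also have "\<dots> \<le> B * B / (D / 2 * D)"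
    using assms pos half by (intro frac_le mult_mono mult_right_mono) auto
  also have "\<dots> = 2 * B\<^sup>2 / D\<^sup>2" using assms by (simp add: power2_eq_square)
  finally have 2: "y / (D - B) - y / D \<le> 2 * B\<^sup>2 / D\<^sup>2" .
  have "s / (D - B) \<le> s / (D / 2)" using assms half by (intro divide_left_mono) auto
  then have 3: "s / (D - B) \<le> 2 * s / D" by (simp add: mult.commute)
  have "(T + y + s) / (D - B) = T / (D - B) + y / (D - B) + s / (D - B)"
    by (simp add: add_divide_distrib)
  moreover have "6 * B\<^sup>2 / D\<^sup>2 = 4 * B\<^sup>2 / D\<^sup>2 + 2 * B\<^sup>2 / D\<^sup>2"
    by (simp add: add_divide_distrib[symmetric])
  ultimately show ?thesis using 1 2 3 by linarith
qed

context convex_domain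
begin

lemma ball_half_bd:
  assumes "z \<in> \<Omega>" "dist u z < bd z"
  shows "u \<in> \<Omega>" "bd z - dist u z \<le> bd u"
  using ball_bd_subset[OF assms(1)] assms(2) bd_le[of z u] by (auto simp: dist_commute subset_eq)

text \<open>A point \<open>u\<close> on a near-geodesic from \<open>x\<close> to \<open>w\<close>, at distance of order \<open>M \<delta>\<close> from \<open>w\<close>,
  is joined to \<open>w + g\<close> by a segment; the support functional at the direction \<open>w - u\<close> controls its
  length up to the smoothness error at scale \<open>1 / M\<close>.\<close>

lemma qh_dist_superderivative:
  assumes smooth: "uniformly_smooth TYPE('a)" and x: "x \<in> \<Omega>" and z: "z \<in> \<Omega>" and "x \<noteq> z" and e: "0 < e"
  shows "\<exists>\<delta>\<^sub>0>0. \<forall>\<delta>>0. \<delta> < \<delta>\<^sub>0 \<longrightarrow>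
      (\<forall>w. dist w z \<le> \<delta> \<longrightarrow> (\<exists>p. superderivative (qh_dist \<Omega> x) (1 / bd z) w \<delta> e p))"
proof -
  define D where "D = bd z"
  have D: "0 < D" unfolding D_def by (rule bd_pos[OF z])
  define \<epsilon> where "\<epsilon> = e * D / 16"
  have "0 < \<epsilon>" using e D by (simp add: \<epsilon>_def)
  then obtain \<beta> where \<beta>: "0 < \<beta>" "\<And>u v :: 'a. norm u = 1 \<Longrightarrow> norm v < \<beta> \<Longrightarrow>
      norm (u + v) + norm (u - v) \<le> 2 + 2 * \<epsilon> * norm v"
    using uniformly_smoothD[OF smooth] by blast
  \<comment> \<open>When \<open>u\<close> is at distance at least \<open>M * \<delta>\<close> from
    \<open>w\<close>, the displacement \<open>g\<close> divided by that distance has norm at most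
    \<open>1 / M < \<beta>\<close>, within reach of the smoothness estimate.\<close>
  define M where "M = 1 / \<beta> + 1"
  have M: "1 \<le> M" "1 / M < \<beta>"
    using \<beta>(1) by (auto simp: M_def field_simps)
  \<comment> \<open>The three bounds yield \<open>B \<le> D / 2\<close>,
    \<open>6 * B\<^sup>2 / D\<^sup>2 \<le> e * \<delta> / 4\<close> and
    \<open>M * \<delta> \<le> dist x w\<close>, the last being room for \<open>u\<close> between
    \<open>x\<close> and \<open>w\<close>.\<close>
  define \<delta>\<^sub>0 where "\<delta>\<^sub>0 = min (min (D / (2 * (3 * M + 2))) (e * D\<^sup>2 / (24 * (3 * M + 2)\<^sup>2))) (dist x z / (M + 1))"
  have "0 < \<delta>\<^sub>0" using D e M \<open>x \<noteq> z\<close> by (simp add: \<delta>\<^sub>0_def)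
  moreover have "\<exists>p. superderivative (qh_dist \<Omega> x) (1 / bd z) w \<delta> e p"
    if \<delta>: "0 < \<delta>" "\<delta> < \<delta>\<^sub>0" and w: "dist w z \<le> \<delta>" for \<delta> w
  proof -
    \<comment> \<open>Bounds the total displacement: \<open>3 * M * \<delta>\<close> from
      \<open>u\<close> to \<open>w\<close>, \<delta> from \<open>w\<close> to \<open>z\<close>, and
      \<delta> for \<open>g\<close>.\<close>
    define B where "B = (3 * M + 2) * \<delta>"
    have "\<delta> < D / (2 * (3 * M + 2))" "\<delta> < e * D\<^sup>2 / (24 * (3 * M + 2)\<^sup>2)" "\<delta> < dist x z / (M + 1)"
      using \<delta>(2) by (auto simp: \<delta>\<^sub>0_def)
    then have small: "\<delta> * (2 * (3 * M + 2)) < D" "\<delta> * (24 * (3 * M + 2)\<^sup>2) < e * D\<^sup>2"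
      "\<delta> * (M + 1) < dist x z"
      using M by (simp_all add: pos_less_divide_eq)
    have "1 * \<delta> \<le> M * \<delta>" using M \<delta> by (intro mult_right_mono) auto
    then have B: "0 \<le> B" "B \<le> D / 2" "\<delta> \<le> B" "3 * (M * \<delta>) + 2 * \<delta> = B"
      using small(1) \<delta> by (auto simp: B_def algebra_simps)
    have "24 * B\<^sup>2 = \<delta> * (\<delta> * (24 * (3 * M + 2)\<^sup>2))"
      by (simp add: B_def power2_eq_square)
    also have "\<dots> \<le> \<delta> * (e * D\<^sup>2)" using small(2) \<delta> by (intro mult_left_mono) auto
    finally have err: "6 * B\<^sup>2 / D\<^sup>2 \<le> e * \<delta> / 4"
      using D by (simp add: field_simps)
    have "dist w z < bd z" using w B \<delta> D by (simp add: D_def[symmetric])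
    note wdom = ball_half_bd[OF z this]
    have wbd: "D - \<delta> \<le> bd w" "bd w \<le> D + \<delta>"
      using wdom(2) bd_le[of w z] w by (auto simp: D_def)
    have "M * \<delta> \<le> dist x w"
      using small(3) w dist_triangle[of x z w] by (simp add: algebra_simps)
    moreover have "0 < M * \<delta>" "0 < e * \<delta> / 4" using M \<delta> e by auto
    ultimately obtain u where u: "u \<in> \<Omega>" "M * \<delta> \<le> dist u w" "dist u w \<le> 3 * (M * \<delta>)"
      and fu: "qh_dist \<Omega> x u \<le> qh_dist \<Omega> x w + e * \<delta> / 4 - dist u w / (bd w + dist u w)"
      using near_geodesic_point[OF x wdom(1), of "M * \<delta>" "e * \<delta> / 4"] by blast
    define T where "T = dist u w"
    have T: "0 < T" "T \<le> B" using u(2,3) \<open>0 < M * \<delta>\<close> B \<delta> by (auto simp: T_def)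
    define v where "v = (1 / T) *\<^sub>R (w - u)"
    have v: "norm v = 1" using T by (simp add: v_def T_def dist_norm norm_minus_commute)
    obtain p :: "'a \<Rightarrow>\<^sub>L real" where p: "norm p \<le> 1" "blinfun_apply p v = 1"
      "\<And>h. blinfun_apply p h \<le> norm (v + h) - 1"
      using smooth_support_functional[OF smooth v] by blast
    have "qh_dist \<Omega> x (w + g) \<le> qh_dist \<Omega> x w + 1 / bd z * blinfun_apply p g + e * \<delta>"
      if g: "norm g \<le> \<delta>" for g
    proof -
      have "dist (w + g) z \<le> norm g + dist w z"
        using norm_triangle_ineq[of g "w - z"] by (simp add: dist_norm algebra_simps)
      then have wg: "dist (w + g) z \<le> 2 * \<delta>" using g w by simp
      moreover have "2 * \<delta> \<le> B" using B \<open>0 < M * \<delta>\<close> by simp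
      ultimately have "dist (w + g) z < bd z" using B D by (simp add: D_def[symmetric])
      note wgdom = ball_half_bd[OF z this]
      have m: "0 < D - B" using B D by simp
      have "D - B \<le> bd (w + g)" using wgdom(2) wg \<open>2 * \<delta> \<le> B\<close> by (simp add: D_def)
      moreover have "D - B \<le> bd u"
        using bd_le[of w u] wbd u(3) B \<delta> by (simp add: dist_commute)
      ultimately have step: "qh_dist \<Omega> x (w + g) \<le> qh_dist \<Omega> x u + dist u (w + g) / (D - B)"
        using qh_dist_segment[OF x u(1) wgdom(1) m] by simp
      define h where "h = (1 / T) *\<^sub>R g"
      have Th: "T * norm h = norm g" "T * blinfun_apply p h = blinfun_apply p g"
        using T by (auto simp: h_def blinfun.scaleR_right)
      have "w + g - u = T *\<^sub>R (v + h)" using T by (simp add: v_def h_def algebra_simps)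
      then have "norm (w + g - u) = T * norm (v + h)" using T by simp
      then have dist_eq: "dist u (w + g) = T * norm (v + h)"
        by (metis dist_commute dist_norm)
      have "M * norm g \<le> M * \<delta>" using g M by (intro mult_left_mono) auto
      then have "M * norm g \<le> T" using u(2) unfolding T_def by (rule order_trans)
      then have "norm g \<le> T / M"
        using M by (simp add: pos_le_divide_eq mult.commute)
      then have "norm h \<le> 1 / M" using T by (simp add: h_def field_simps)
      then have "norm (v + h) + norm (v - h) \<le> 2 + 2 * \<epsilon> * norm h"
        using \<beta>(2)[OF v] M(2) by simp
      \<comment> \<open>The support inequality at \<open>- h\<close> bounds
        \<open>norm (v - h)\<close> from below, which smoothness turns into an upper bound on
        \<open>norm (v + h)\<close>.\<close>
      moreover have "- blinfun_apply p h \<le> norm (v - h) - 1"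
        using p(3)[of "- h"] by (simp add: blinfun.minus_right)
      ultimately have "norm (v + h) \<le> 1 + blinfun_apply p h + 2 * \<epsilon> * norm h" by linarith
      then have "dist u (w + g) \<le> T * (1 + blinfun_apply p h + 2 * \<epsilon> * norm h)"
        unfolding dist_eq using T by (intro mult_left_mono) auto
      also have "\<dots> = T + blinfun_apply p g + 2 * \<epsilon> * norm g"
        by (simp add: distrib_left Th(2) flip: Th(1))
      also have "\<dots> \<le> T + blinfun_apply p g + 2 * \<epsilon> * \<delta>"
        using g \<open>0 < \<epsilon>\<close> by simp
      finally have len: "dist u (w + g) / (D - B) \<le> (T + blinfun_apply p g + 2 * \<epsilon> * \<delta>) / (D - B)"
        using m by (intro divide_right_mono) auto
      have "bd w + T \<le> D + B" using wbd u(3) B \<delta> by (simp add: T_def)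
      moreover have "0 < bd w + T" using bd_pos[OF wdom(1)] T by simp
      ultimately have T_le: "T / (D + B) \<le> T / (bd w + T)" using T by (intro divide_left_mono) auto
      define Q where "Q = (T + blinfun_apply p g + 2 * \<epsilon> * \<delta>) / (D - B)"
      have "\<bar>blinfun_apply p g\<bar> \<le> B"
        using norm_blinfun_apply_le[OF p(1), of g] g B by simp
      then have "Q - T / (D + B) \<le> blinfun_apply p g / D + 6 * B\<^sup>2 / D\<^sup>2 + 2 * (2 * \<epsilon> * \<delta>) / D"
        unfolding Q_def using D B T \<open>0 < \<epsilon>\<close> \<delta> by (intro superderivative_error_bound) auto
      also have "2 * (2 * \<epsilon> * \<delta>) / D = e * \<delta> / 4" using D by (simp add: \<epsilon>_def)
      finally have "Q - T / (D + B) \<le> blinfun_apply p g / D + e * \<delta> / 2" using err by simp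
      moreover have "0 < e * \<delta>" using e \<delta> by simp
      \<comment> \<open>Three errors of \<open>e * \<delta> / 4\<close> are collected: from the
        near-geodesic, from the variation of \<open>bd\<close>, and from smoothness.\<close>
      ultimately have "qh_dist \<Omega> x (w + g) \<le> qh_dist \<Omega> x w + blinfun_apply p g / D + e * \<delta>"
        using step fu[folded T_def] len[folded Q_def] T_le by linarith
      then show ?thesis by (simp add: D_def)
    qed
    then show ?thesis using p v unfolding superderivative_def by blast
  qed
  ultimately show ?thesis by blast
qed

end

theorem qh_dist_has_nonzero_derivative:
  fixes \<Omega> :: "'a::banach set"
  assumes "convex_domain \<Omega>" "uniformly_smooth TYPE('a)" "x \<in> \<Omega>" "z \<in> \<Omega>" "x \<noteq> z"
  obtains D where "(qh_dist \<Omega> x has_derivative D) (at z)" "\<exists>h. D h \<noteq> 0"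
proof -
  interpret convex_domain \<Omega> by fact
  have D: "0 < bd z" by (rule bd_pos[OF assms(4)])
  have dom: "u \<in> \<Omega>" "bd z / 2 \<le> bd u" if "dist u z < bd z / 2" for u
    using ball_half_bd[OF assms(4), of u] that D by auto
  \<comment> \<open>On this ball \<open>bd\<close> is at least \<open>bd z / 2\<close>, hence the
    Lipschitz constant \<open>2 / bd z\<close>.\<close>
  interpret quasiconvex_superdifferentiable "qh_dist \<Omega> x" z "1 / bd z" "bd z / 2"
  proof
    show "qh_dist \<Omega> x v \<le> qh_dist \<Omega> x u + 2 * (1 / bd z) * dist u v"
      if "dist u z < bd z / 2" "dist v z < bd z / 2" for u v
      using qh_dist_segment[OF assms(3) dom(1)[OF that(1)] dom(1)[OF that(2)], of "bd z / 2"]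
        dom(2)[OF that(1)] dom(2)[OF that(2)] D by (simp add: mult.commute)
    show "qh_dist \<Omega> x ((1 - t) *\<^sub>R u + t *\<^sub>R v) \<le> C"
      if "dist u z < bd z / 2" "dist v z < bd z / 2" "0 \<le> t" "t \<le> 1"
        "qh_dist \<Omega> x u \<le> C" "qh_dist \<Omega> x v \<le> C" for u v t C
      using qh_dist_quasiconvex[OF assms(3) dom(1)[OF that(1)] dom(1)[OF that(2)] that(3-6)] .
    show "\<exists>\<delta>\<^sub>0>0. \<forall>\<delta>>0. \<delta> < \<delta>\<^sub>0 \<longrightarrow>
        (\<forall>w. dist w z \<le> \<delta> \<longrightarrow> (\<exists>p. superderivative (qh_dist \<Omega> x) (1 / bd z) w \<delta> e p))" if "0 < e" for e
      by (rule qh_dist_superderivative[OF assms(2-5) that])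
  qed (use D in auto)
  show thesis using has_nonzero_derivative that by blast
qed

section \<open>Internally tangent spheres\<close>

lemma has_derivative_neg_imp_less:
  assumes "(f has_derivative D) (at z)" "D h < (0::real)"
  shows "\<forall>\<^sub>F t in at_right 0. f (z + t *\<^sub>R h) < f z"
proof -
  have line: "((\<lambda>t. z + t *\<^sub>R h) has_derivative (\<lambda>t. t *\<^sub>R h)) (at 0 within {0<..})"
    by (auto intro!: derivative_eq_intros)
  have "(f has_derivative D) (at (z + 0 *\<^sub>R h))" using assms(1) by simp
  from has_derivative_compose[OF line this]
  have "((\<lambda>t. f (z + t *\<^sub>R h)) has_field_derivative D h) (at 0 within {0<..})"
    unfolding has_field_derivative_def
    by (simp add: linear_scale[OF has_derivative_linear[OF assms(1)]] mult.commute[of "D h"] mult_commute_abs)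
  then have "((\<lambda>t. (f (z + t *\<^sub>R h) - f z) / t) \<longlongrightarrow> D h) (at_right 0)"
    unfolding has_field_derivative_iff by simp
  then have "\<forall>\<^sub>F t in at_right 0. (f (z + t *\<^sub>R h) - f z) / t < 0"
    using assms(2) by (rule order_tendstoD(2))
  then show ?thesis
    using eventually_at_right_less[of 0] by eventually_elim (simp add: divide_less_0_iff)
qed

text \<open>A direction in which \<open>g\<close> decreases to first order cannot increase
  \<open>f\<close> to first order, so \<open>F\<close> is nonpositive on the half-space where
  \<open>G\<close> is negative. A linear functional bounded above on that half-space is a multiple
  of \<open>G\<close>, here a nonzero one.\<close>

lemma kernel_eq_of_sublevel_inclusion:
  fixes f g :: "'a::real_normed_vector \<Rightarrow> real"
  assumes f: "(f has_derivative F) (at z)" and g: "(g has_derivative G) (at z)"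
    and F: "\<exists>h. F h \<noteq> 0" and G: "\<exists>h. G h \<noteq> 0"
    and incl: "\<forall>\<^sub>F u in at z. g u \<le> g z \<longrightarrow> f u \<le> f z"
  shows "F h = 0 \<longleftrightarrow> G h = 0"
proof -
  interpret F: linear F by (rule has_derivative_linear[OF f])
  interpret G: linear G by (rule has_derivative_linear[OF g])
  have sign: "F h \<le> 0" if "G h < 0" for h
  proof (rule ccontr)
    assume "\<not> F h \<le> 0"
    have "((\<lambda>u. - f u) has_derivative (\<lambda>h. - F h)) (at z)"
      by (rule has_derivative_minus[OF f])
    then have "\<forall>\<^sub>F t in at_right 0. - f (z + t *\<^sub>R h) < - f z"
      using \<open>\<not> F h \<le> 0\<close> by (intro has_derivative_neg_imp_less) auto
    moreover have "\<forall>\<^sub>F t in at_right 0. g (z + t *\<^sub>R h) < g z"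
      by (rule has_derivative_neg_imp_less[OF g that])
    moreover have "\<forall>\<^sub>F t in at_right 0. g (z + t *\<^sub>R h) \<le> g z \<longrightarrow> f (z + t *\<^sub>R h) \<le> f z"
    proof -
      have "h \<noteq> 0" using that G.zero by auto
      have "((\<lambda>t. z + t *\<^sub>R h) \<longlongrightarrow> z + 0 *\<^sub>R h) (at_right 0)"
        by (intro tendsto_intros)
      then have "filterlim (\<lambda>t. z + t *\<^sub>R h) (at z) (at_right 0)"
        using \<open>h \<noteq> 0\<close> eventually_at_right_less[of "0::real"]
        by (intro filterlim_atI) (auto elim: eventually_mono)
      then show ?thesis using incl unfolding filterlim_iff by blast
    qed
    ultimately have "\<forall>\<^sub>F t in at_right (0::real). False" by eventually_elim auto
    then show False by simp
  qed
  obtain a where "G a \<noteq> 0" using G by blast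
  then obtain u where u: "G u < 0" using G.neg[of a] by (metis linorder_neqE neg_less_0_iff_less)
  have ker: "F h = 0" if "G h = 0" for h
  proof (rule ccontr)
    assume "F h \<noteq> 0"
    \<comment> \<open>Adding multiples of \<open>h\<close> to \<open>u\<close> leaves
      \<open>G\<close> negative but moves \<open>F\<close> freely; this \<open>s\<close> makes
      \<open>F\<close> equal to 1.\<close>
    define s where "s = (1 - F u) / F h"
    have "G (s *\<^sub>R h + u) < 0" using that u by (simp add: G.add G.scale)
    then have "F (s *\<^sub>R h + u) \<le> 0" by (rule sign)
    moreover have "F (s *\<^sub>R h + u) = 1" using \<open>F h \<noteq> 0\<close> by (simp add: F.add F.scale s_def)
    ultimately show False by simp
  qed
  obtain b where b: "F b \<noteq> 0" using F by blast
  then have "G b \<noteq> 0" using ker by blast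
  have "F (h - (G h / G b) *\<^sub>R b) = 0"
    using \<open>G b \<noteq> 0\<close> by (intro ker) (simp add: G.diff G.scale)
  then show ?thesis using b ker by (auto simp: F.diff F.scale)
qed

theorem corollary3p5:
  fixes \<Omega> :: "'a::banach set" and x y z :: 'a and r s :: real
  assumes "\<exists>B :: 'a set. independent B \<and> card B = 2"
    and "uniformly_smooth TYPE('a)"
    and "\<Omega> \<noteq> {}" and "open \<Omega>" and "connected \<Omega>" and "\<Omega> \<noteq> UNIV"
    and "convex \<Omega>"
    and "x \<in> \<Omega>" and "y \<in> \<Omega>" and "r > 0" and "s > 0"
    and "qh_ball \<Omega> y s \<subseteq> qh_ball \<Omega> x r"
    and "z \<in> qh_sphere \<Omega> x r \<inter> qh_sphere \<Omega> y s"
  shows "\<exists>T. is_qh_tangent_space \<Omega> x r z T \<and> is_qh_tangent_space \<Omega> y s z T"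
proof -
  have dom: "convex_domain \<Omega>" by unfold_locales fact+
  have z: "z \<in> \<Omega>" "qh_dist \<Omega> x z = r" "qh_dist \<Omega> y z = s"
    using assms(13) by (auto simp: qh_sphere_def)
  have "x \<noteq> z" "y \<noteq> z"
    using convex_domain.qh_dist_refl[OF dom z(1)] z assms(10,11) by auto
  obtain F where F: "(qh_dist \<Omega> x has_derivative F) (at z)" "\<exists>h. F h \<noteq> 0"
    using qh_dist_has_nonzero_derivative[OF dom assms(2,8) z(1) \<open>x \<noteq> z\<close>] by blast
  obtain G where G: "(qh_dist \<Omega> y has_derivative G) (at z)" "\<exists>h. G h \<noteq> 0"
    using qh_dist_has_nonzero_derivative[OF dom assms(2,9) z(1) \<open>y \<noteq> z\<close>] by blast
  \<comment> \<open>The inclusion of balls speaks of points of \<Omega> only, and \<Omega> is a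
    neighbourhood of \<open>z\<close>.\<close>
  have "\<forall>\<^sub>F u in at z. u \<in> \<Omega>"
    by (rule eventually_at_in_open'[OF assms(4) z(1)])
  then have "\<forall>\<^sub>F u in at z. qh_dist \<Omega> y u \<le> qh_dist \<Omega> y z \<longrightarrow> qh_dist \<Omega> x u \<le> qh_dist \<Omega> x z"
    by eventually_elim (use assms(12) z in \<open>auto simp: qh_ball_def\<close>)
  then have "{z + h | h. F h = 0} = {z + h | h. G h = 0}"
    using kernel_eq_of_sublevel_inclusion[OF F(1) G(1) F(2) G(2)] by simp
  moreover have "is_qh_tangent_space \<Omega> x r z {z + h | h. F h = 0}"
    using assms(10,13) F(1) unfolding is_qh_tangent_space_def by blast
  moreover have "is_qh_tangent_space \<Omega> y s z {z + h | h. G h = 0}"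
    using assms(11,13) G(1) unfolding is_qh_tangent_space_def by blast
  ultimately show ?thesis by auto
qed

end
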